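(* For every $w\in S_\mathbb{Z}$ and every interval $[p,q]\subset\mathbb{Z}$ containing all integers moved by $w$, let $\mathfrak{S}^{[p,q]}_w$ be as in the context. Then the coefficientwise limit $$\overleftarrow{\mathfrak{S}}_w:=\lim_{p\to-\infty,\ q\to\infty}\mathfrak{S}^{[p,q]}_w$$ exists, is an element of $\overleftarrow{R}$ (the back stable Schubert polynomial), and has the monomial expansion $$\overleftarrow{\mathfrak{S}}_w=\sum_{a_1a_2\cdots a_\ell\in R(w)}\ \sum_{\substack{b_1\le b_2\le\cdots\le b_\ell\\ a_i<a_{i+1}\Rightarrow b_i<b_{i+1}\\ b_i\le a_i}} x_{b_1}x_{b_2}\cdots x_{b_\ell},$$ where the $b_i$ range over $\mathbb{Z}$. Moreover, $\{\overleftarrow{\mathfrak{S}}_w\mid w\in S_\mathbb{Z}\}$ is the unique family of elements of $\overleftarrow{R}$ such that $\overleftarrow{\mathfrak{S}}_{\mathrm{id}}=1$, each $\overleftarrow{\mathfrak{S}}_w$ is homogeneous of degree $\ell(w)$, and for all $i\in\mathbb{Z}$, $A_i\overleftarrow{\mathfrak{S}}_w=\overleftarrow{\mathfrak{S}}_{ws_i}$ if $ws_i<w$ (i.e. $\ell(ws_i)<\ell(w)$) and $A_i\overleftarrow{\mathfrak{S}}_w=0$ otherwise.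
   Context: $S_\mathbb{Z}$ is the group of permutations of $\mathbb{Z}$ fixing all but finitely many integers, generated by the transpositions $s_i$ ($i\in\mathbb{Z}$) exchanging $i$ and $i+1$; $\ell$ is Coxeter length and $R(w)$ is the set of reduced words $a_1\cdots a_\ell$ of $w$ (so $w=s_{a_1}\cdots s_{a_\ell}$, $\ell=\ell(w)$). $S_+$ is the subgroup generated by $s_1,s_2,\dots$ and $S_n\subset S_+$ the permutations of $\{1,\dots,n\}$. For $w\in S_+$, $\mathfrak{S}_w\in\mathbb{Q}[x_1,x_2,\dots]$ is the Schubert polynomial: for $w\in S_n$, $\mathfrak{S}_{w_0^{(n)}}=x_1^{n-1}x_2^{n-2}\cdots x_{n-1}$ ($w_0^{(n)}$ the longest element of $S_n$) and $\mathfrak{S}_w=A_i\mathfrak{S}_{ws_i}$ whenever $ws_i>w$, where $A_if=(f-s_if)/(x_i-x_{i+1})$ and $s_i$ exchanges $x_i,x_{i+1}$. Let $\gamma$ denote both the automorphism of $S_\mathbb{Z}$ with $s_i\mapsto s_{i+1}$ and the ring automorphism $x_i\mapsto x_{i+1}$. For $w$ moving only integers in $[p,q]$, $\mathfrak{S}^{[p,q]}_w:=\gamma^{p-1}(\mathfrak{S}_{\gamma^{1-p}(w)})$. Let $\overleftarrow{R}$ be the ring of formal power series in the variables $x_i$ ($i\in\mathbb{Z}$) of bounded total degree, involving only $x_i$ with $i\le N$ for some $N$, and invariant under exchanging $x_i$ and $x_{i+1}$ for all $i<b$ for some $b$; it equals $\Lambda\otimes\mathbb{Q}[x]$ where $\Lambda$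 is the ring of symmetric functions in $x_i$, $i\le 0$, and $\mathbb{Q}[x]=\mathbb{Q}[x_i\mid i\in\mathbb{Z}]$. The operators $A_i$ ($i\in\mathbb{Z}$) act on $\overleftarrow{R}$ by the same formula $A_if=(f-s_if)/(x_i-x_{i+1})$. *)

theory Defs
  imports Complex_Main "HOL-Library.Multiset" "HOL-Combinatorics.Perm"
begin

section \<open>Formal power series in arbitrarily many variables\<close>

text \<open>
  A monomial in the variables \<open>x\<^sub>v\<close> is a finite multiset over \<open>'v\<close> (multiplicities are
  exponents, \<^const>\<open>size\<close> is the total degree). Any function from monomials to coefficients is
  allowed. Polynomials are treated as the power series with finitely many nonzero coefficients.
\<close>

typedef ('v, 'a) mfps = "UNIV :: ('v multiset \<Rightarrow> 'a) set"
  morphisms coeff Abs_mfps by simp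

setup_lifting type_definition_mfps

lemma mfps_eqI: "(\<And>M. coeff f M = coeff g M) \<Longrightarrow> f = g"
  by transfer auto

lemma finite_submultisets: "finite {A. A \<subseteq># M}"
proof (rule finite_subset)
  show "{A. A \<subseteq># M} \<subseteq> mset ` {xs. set xs \<subseteq> set_mset M \<and> length xs \<le> size M}"
  proof
    fix A assume "A \<in> {A. A \<subseteq># M}"
    moreover obtain xs where "A = mset xs" using ex_mset by metis
    ultimately show "A \<in> mset ` {xs. set xs \<subseteq> set_mset M \<and> length xs \<le> size M}"
      by (metis (mono_tags, lifting) image_eqI mem_Collect_eq set_mset_mono set_mset_mset
          size_mset size_mset_mono)
  qed
  show "finite (mset ` {xs. set xs \<subseteq> set_mset M \<and> length xs \<le> size M})"
    by (intro finite_imageI finite_lists_length_le) simp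
qed

lemma finite_splits [simp]: "finite {(A, B). A + B = M}" for M :: "'v multiset"
  by (rule finite_subset[of _ "{A. A \<subseteq># M} \<times> {A. A \<subseteq># M}"])
     (auto simp: finite_submultisets)

instantiation mfps :: (type, comm_ring_1) comm_ring_1
begin

lift_definition zero_mfps :: "('a, 'b) mfps" is "\<lambda>_. 0" .
lift_definition one_mfps :: "('a, 'b) mfps" is "\<lambda>M. if M = {#} then 1 else 0" .
lift_definition plus_mfps :: "('a, 'b) mfps \<Rightarrow> ('a, 'b) mfps \<Rightarrow> ('a, 'b) mfps"
  is "\<lambda>f g M. f M + g M" .
lift_definition minus_mfps :: "('a, 'b) mfps \<Rightarrow> ('a, 'b) mfps \<Rightarrow> ('a, 'b) mfps"
  is "\<lambda>f g M. f M - g M" .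
lift_definition uminus_mfps :: "('a, 'b) mfps \<Rightarrow> ('a, 'b) mfps"
  is "\<lambda>f M. - f M" .
lift_definition times_mfps :: "('a, 'b) mfps \<Rightarrow> ('a, 'b) mfps \<Rightarrow> ('a, 'b) mfps"
  is "\<lambda>f g M. \<Sum>(A, B) | A + B = M. f A * g B" .

instance
proof
  fix a b c :: "('a, 'b) mfps"
  show "a * b * c = a * (b * c)"
  proof (rule mfps_eqI)
    fix M
    have "coeff (a * b * c) M
        = (\<Sum>p | fst p + snd p = M. \<Sum>q | fst q + snd q = fst p.
             coeff a (fst q) * coeff b (snd q) * coeff c (snd p))"
      by (simp add: times_mfps.rep_eq case_prod_unfold sum_distrib_right)
    also have "\<dots> = (\<Sum>(p, q) \<in> (SIGMA p:{p. fst p + snd p = M}. {q. fst q + snd q = fst p}).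
             coeff a (fst q) * coeff b (snd q) * coeff c (snd p))"
      by (rule sum.Sigma) (use finite_splits in \<open>auto simp: case_prod_unfold\<close>)
    also have "\<dots> = (\<Sum>(p, q) \<in> (SIGMA p:{p. fst p + snd p = M}. {q. fst q + snd q = snd p}).
             coeff a (fst p) * (coeff b (fst q) * coeff c (snd q)))"
      by (rule sum.reindex_bij_witness[of _
            "\<lambda>((x, _), (y, z)). ((x + y, z), (x, y))" "\<lambda>((_, z), (x, y)). ((x, y + z), (y, z))"])
         (auto simp: algebra_simps)
    also have "\<dots> = (\<Sum>p | fst p + snd p = M. \<Sum>q | fst q + snd q = snd p.
             coeff a (fst p) * (coeff b (fst q) * coeff c (snd q)))"
      by (rule sum.Sigma[symmetric]) (use finite_splits in \<open>auto simp: case_prod_unfold\<close>)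
    also have "\<dots> = coeff (a * (b * c)) M"
      by (simp add: times_mfps.rep_eq case_prod_unfold sum_distrib_left)
    finally show "coeff (a * b * c) M = coeff (a * (b * c)) M" .
  qed
  show "a * b = b * a"
    by (rule mfps_eqI, unfold times_mfps.rep_eq,
        rule sum.reindex_bij_witness[of _ "\<lambda>(x, y). (y, x)" "\<lambda>(x, y). (y, x)"])
       (auto simp: algebra_simps)
  show "1 * a = a"
  proof (rule mfps_eqI)
    fix M
    have "coeff (1 * a) M = (\<Sum>(A, B) | A + B = M. (if A = {#} then 1 else 0) * coeff a B)"
      by (simp add: times_mfps.rep_eq one_mfps.rep_eq)
    also have "\<dots> = (\<Sum>(A, B) \<in> {({#} :: 'a multiset, M)}. (if A = {#} then 1 else 0) * coeff a B)"
      by (rule sum.mono_neutral_right) (auto split: if_splits)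
    finally show "coeff (1 * a) M = coeff a M" by simp
  qed
  show "(a + b) * c = a * c + b * c"
    by (rule mfps_eqI)
       (simp add: times_mfps.rep_eq plus_mfps.rep_eq case_prod_unfold sum.distrib algebra_simps)
  show "(0 :: ('a, 'b) mfps) \<noteq> 1"
    by transfer (auto simp: fun_eq_iff)
qed (transfer; simp add: algebra_simps)+

end

lift_definition mvar :: "'v \<Rightarrow> ('v, 'a::comm_ring_1) mfps"
  is "\<lambda>v M. if M = {#v#} then 1 else 0" .

text \<open>The substitution \<open>x\<^sub>v \<mapsto> x\<^bsub>\<sigma> v\<^esub>\<close>; only meaningful for bijective \<open>\<sigma>\<close>.\<close>

lift_definition rename :: "('v \<Rightarrow> 'v) \<Rightarrow> ('v, 'a) mfps \<Rightarrow> ('v, 'a) mfps"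
  is "\<lambda>\<sigma> f M. f (image_mset (inv \<sigma>) M)" .

lemma rename_mvar:
  assumes "bij \<sigma>"
  shows "rename \<sigma> (mvar v) = mvar (\<sigma> v)"
proof (rule mfps_eqI)
  fix M
  have "image_mset (inv \<sigma>) M = {#v#} \<longleftrightarrow> M = {#\<sigma> v#}"
  proof
    assume "image_mset (inv \<sigma>) M = {#v#}"
    then have "image_mset \<sigma> (image_mset (inv \<sigma>) M) = {#\<sigma> v#}" by simp
    then show "M = {#\<sigma> v#}"
      using assms by (simp add: multiset.map_comp o_def bij_is_surj surj_f_inv_f)
  qed (use assms in \<open>simp add: bij_is_inj\<close>)
  then show "coeff (rename \<sigma> (mvar v)) M = coeff (mvar (\<sigma> v)) M"
    by (simp add: rename.rep_eq mvar.rep_eq)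
qed

lemma rename_mult:
  assumes "bij \<sigma>"
  shows "rename \<sigma> (f * g) = rename \<sigma> f * rename \<sigma> g"
proof (rule mfps_eqI)
  fix M
  have [simp]: "image_mset \<sigma> (image_mset (inv \<sigma>) A) = A"
      "image_mset (inv \<sigma>) (image_mset \<sigma> A) = A" for A
    using assms by (simp_all add: multiset.map_comp o_def bij_is_surj bij_is_inj surj_f_inv_f)
  show "coeff (rename \<sigma> (f * g)) M = coeff (rename \<sigma> f * rename \<sigma> g) M"
    unfolding rename.rep_eq times_mfps.rep_eq
    by (rule sum.reindex_bij_witness[of _
          "\<lambda>(A, B). (image_mset (inv \<sigma>) A, image_mset (inv \<sigma>) B)"
          "\<lambda>(A, B). (image_mset \<sigma> A, image_mset \<sigma> B)"])
       (auto simp flip: image_mset_union)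
qed

definition homogeneous :: "nat \<Rightarrow> ('v, 'a::zero) mfps \<Rightarrow> bool" where
  "homogeneous d f \<longleftrightarrow> (\<forall>M. coeff f M \<noteq> 0 \<longrightarrow> size M = d)"

text \<open>Coefficientwise convergence is with respect to the discrete topology on coefficients.\<close>

definition coeffwise_limit :: "('b \<Rightarrow> ('v, 'a) mfps) \<Rightarrow> 'b filter \<Rightarrow> ('v, 'a) mfps \<Rightarrow> bool" where
  "coeffwise_limit f F L \<longleftrightarrow> (\<forall>M. \<forall>\<^sub>F p in F. coeff (f p) M = coeff L M)"

text \<open>Possibly infinite sums in which every monomial occurs in only finitely many terms.\<close>

definition has_formal_sum ::
    "('i \<Rightarrow> ('v, 'a::comm_monoid_add) mfps) \<Rightarrow> 'i set \<Rightarrow> ('v, 'a) mfps \<Rightarrow> bool" where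
  "has_formal_sum F I f \<longleftrightarrow>
     (\<forall>M. finite {i\<in>I. coeff (F i) M \<noteq> 0} \<and>
          coeff f M = (\<Sum>i | i \<in> I \<and> coeff (F i) M \<noteq> 0. coeff (F i) M))"


section \<open>The group of finitely supported permutations of the integers\<close>

text \<open>
  This group is the library type \<^typ>\<open>int perm\<close>, with \<open>(v * w)(j) = v (w j)\<close> and
  \<^term>\<open>affected w\<close> the set of integers moved by \<open>w\<close>.
\<close>

definition s :: "int \<Rightarrow> int perm" where
  "s i = Perm.swap i (i + 1)"

definition word_perm :: "int list \<Rightarrow> int perm" where
  "word_perm a = prod_list (map s a)"

definition len :: "int perm \<Rightarrow> nat" where
  "len w = (LEAST n. \<exists>a. length a = n \<and> word_perm a = w)"

definition reduced_words :: "int perm \<Rightarrow> int list set" where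
  "reduced_words w = {a. word_perm a = w \<and> length a = len w}"

definition Sym :: "nat \<Rightarrow> int perm set" where
  "Sym n = {w. affected w \<subseteq> {1..int n}}"

text \<open>The power \<open>\<gamma>\<^sup>k\<close> of the automorphism \<open>\<gamma>\<close>, for an arbitrary integer \<open>k\<close>.\<close>

lift_definition shift_perm :: "int \<Rightarrow> int perm \<Rightarrow> int perm"
  is "\<lambda>k w j. w (j - k) + k"
proof -
  fix k :: int and w :: "int \<Rightarrow> int"
  assume w: "bij w \<and> finite {a. w a \<noteq> a}"
  have b: "bij (\<lambda>j. j + c)" for c :: int
    by (rule bij_betw_byWitness[of _ "\<lambda>j. j - c"]) auto
  have "bij ((\<lambda>j. j + k) \<circ> w \<circ> (\<lambda>j. j + (- k)))"
    using w b by (intro bij_comp) blast+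
  moreover have "{a. w (a - k) + k \<noteq> a} = (\<lambda>j. j + k) ` {a. w a \<noteq> a}"
  proof (intro equalityI subsetI)
    fix x assume "x \<in> {a. w (a - k) + k \<noteq> a}"
    then show "x \<in> (\<lambda>j. j + k) ` {a. w a \<noteq> a}"
      by (intro image_eqI[of _ _ "x - k"]) auto
  qed auto
  ultimately show "bij (\<lambda>j. w (j - k) + k) \<and> finite {a. w (a - k) + k \<noteq> a}"
    using w by (simp add: o_def)
qed

lemma shift_perm_mult: "shift_perm k (v * w) = shift_perm k v * shift_perm k w"
  by transfer auto

lemma shift_perm_shift_perm: "shift_perm k (shift_perm l w) = shift_perm (k + l) w"
  by transfer (auto simp: algebra_simps)

lemma shift_perm_s: "shift_perm k (s i) = s (i + k)"
  unfolding s_def by (rule perm_eqI) (auto simp: shift_perm.rep_eq swap.rep_eq transpose_def)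


section \<open>Divided differences and Schubert polynomials\<close>

text \<open>
  The quotient \<open>(f - s\<^sub>i f) / (x\<^sub>i - x\<^bsub>i+1\<^esub>)\<close>: the divisor is not a zero divisor in the
  ring of all formal power series, and it always divides \<open>f - s\<^sub>i f\<close>.
\<close>

definition divdiff :: "int \<Rightarrow> (int, rat) mfps \<Rightarrow> (int, rat) mfps" where
  "divdiff i f = (THE g. (mvar i - mvar (i + 1)) * g = f - rename (Perm.apply (s i)) f)"

inductive schubert_rel :: "nat \<Rightarrow> int perm \<Rightarrow> (int, rat) mfps \<Rightarrow> bool" for n where
  longest: "w \<in> Sym n \<Longrightarrow> (\<And>v. v \<in> Sym n \<Longrightarrow> len v \<le> len w) \<Longrightarrow>
    schubert_rel n w (\<Prod>i\<in>{1..<n}. mvar (int i) ^ (n - i))"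
| descend: "schubert_rel n (w * s i) f \<Longrightarrow> 1 \<le> i \<Longrightarrow> i < int n \<Longrightarrow> len (w * s i) > len w \<Longrightarrow>
    schubert_rel n w (divdiff i f)"

text \<open>
  For \<open>w\<close> in the union of the groups \<^term>\<open>Sym n\<close>, the result depends neither on the chain of
  descents nor on \<open>n\<close>.
\<close>

definition schubert :: "int perm \<Rightarrow> (int, rat) mfps" where
  "schubert w = (THE f. \<exists>n. schubert_rel n w f)"

text \<open>
  Only used when \<^term>\<open>affected w \<subseteq> {p..q}\<close>; the value does not depend on \<open>q\<close>.
\<close>

definition schubert_interval :: "int \<Rightarrow> int \<Rightarrow> int perm \<Rightarrow> (int, rat) mfps" where
  "schubert_interval p q w = rename (\<lambda>j. j + (p - 1)) (schubert (shift_perm (1 - p) w))"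


section \<open>Back stable Schubert polynomials\<close>

definition back_stable_ring :: "(int, rat) mfps set" where
  "back_stable_ring = {f.
     (\<exists>d. \<forall>M. coeff f M \<noteq> 0 \<longrightarrow> size M \<le> d) \<and>
     (\<exists>N. \<forall>M. coeff f M \<noteq> 0 \<longrightarrow> (\<forall>i\<in>#M. i \<le> N)) \<and>
     (\<exists>b. \<forall>i<b. rename (Perm.apply (s i)) f = f)}"

definition back_schubert :: "int perm \<Rightarrow> (int, rat) mfps" where
  "back_schubert w =
     (THE L. coeffwise_limit (\<lambda>(p, q). schubert_interval p q w) (at_bot \<times>\<^sub>F at_top) L)"

definition compatible_seqs :: "int list \<Rightarrow> int list set" where
  "compatible_seqs a = {b. length b = length a \<and> sorted b \<and>
     (\<forall>i. Suc i < length a \<longrightarrow> a ! i < a ! Suc i \<longrightarrow> b ! i < b ! Suc i) \<and>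
     (\<forall>i < length a. b ! i \<le> a ! i)}"

end

theory Submission
  imports Defs
begin

text \<open>
  Following Fomin and Stanley, take the product over \<open>k \<ge> p\<close> of
  \<open>h\<^sub>k(x\<^sub>k) = \<cdots> (1 + x\<^sub>k u\<^bsub>k+1\<^esub>) (1 + x\<^sub>k u\<^sub>k)\<close> in the nilCoxeter algebra. Its expansion
  is the sum over reduced words and compatible sequences with entries \<open>\<ge> p\<close>. The Yang--Baxter
  relation gives \<open>h\<^sub>k(x) h\<^sub>k(y) = h\<^sub>k(y) h\<^sub>k(x)\<close>; since
  \<open>h\<^sub>i(x\<^sub>i) h\<^bsub>i+1\<^esub>(x\<^bsub>i+1\<^esub>) = h\<^sub>i(x\<^sub>i) h\<^sub>i(x\<^bsub>i+1\<^esub>) (1 - x\<^bsub>i+1\<^esub> u\<^sub>i)\<close>,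
  the divided difference \<open>A\<^sub>i\<close> acts on the product as right multiplication by \<open>u\<^sub>i\<close>. Hence the
  coefficients of the product satisfy the recursion of the Schubert polynomials, and the
  Schubert polynomial of \<open>w\<close> on \<open>[p, q]\<close> is the part of the back stable series in the
  variables \<open>x\<^sub>v\<close> with \<open>v \<ge> p\<close>.
  The family is unique because two solutions that agree in smaller length differ by a series
  which is invariant under all \<open>s\<^sub>i\<close> but has bounded variable indices, thus by a constant.
\<close>

notation Perm.apply (infixl "\<langle>$\<rangle>" 999)

section \<open>Length, descents and reduced words\<close>

lemma apply_s: "s i \<langle>$\<rangle> j = (if j = i then i + 1 else if j = i + 1 then i else j)"
  by (simp add: s_def swap.rep_eq transpose_def)

lemma apply_times_s:
  "(w * s i) \<langle>$\<rangle> j = (if j = i then w \<langle>$\<rangle> (i + 1) else if j = i + 1 then w \<langle>$\<rangle> i else w \<langle>$\<rangle> j)"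
  by (simp add: apply_times apply_s)

lemma s_times_s [simp]: "s i * s i = 1"
  by (simp add: s_def)

lemma times_s_s [simp]: "w * s i * s i = w"
  by (simp add: mult.assoc)

lemma inv_s [simp]: "inv (Perm.apply (s i)) = Perm.apply (s i)"
  unfolding s_def by (metis apply_inverse inverse_swap)

lemma apply_neq_Suc: "(w :: int perm) \<langle>$\<rangle> (i + 1) \<noteq> w \<langle>$\<rangle> i"
  by (simp add: apply_inj)

section \<open>Coxeter length as an inversion number\<close>

definition inversions :: "int perm \<Rightarrow> (int \<times> int) set" where
  "inversions w = {(i, j). i < j \<and> w \<langle>$\<rangle> j < w \<langle>$\<rangle> i}"

lemma inversions_1 [simp]: "inversions 1 = {}"
  by (auto simp: inversions_def)

text \<open>If one end of an inversion lies outside \<open>{a..b}\<close>, then so does the other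
  end or its value. Both ends are then fixed and cannot be inverted.\<close>

lemma inversions_bounded:
  assumes "affected w \<subseteq> {a..b}"
  shows "inversions w \<subseteq> {a..b} \<times> {a..b}"
proof -
  have fixed: "w \<langle>$\<rangle> j = j" if "j \<notin> {a..b} \<or> w \<langle>$\<rangle> j \<notin> {a..b}" for j
    using that assms apply_affected[of w j] by (auto simp: in_affected)
  have "i \<in> {a..b} \<and> j \<in> {a..b}" if "i < j" "w \<langle>$\<rangle> j < w \<langle>$\<rangle> i" for i j
    using that fixed[of i] fixed[of j] by (auto; smt (verit))
  then show ?thesis by (auto simp: inversions_def)
qed

lemma affected_bounds: obtains a b where "affected w \<subseteq> {a..b :: int}"
proof (cases "w = 1")
  case False
  then show ?thesis
    by (intro that[of "Min (affected w)" "Max (affected w)"]) auto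
qed (use that[of 0 0] in auto)

lemma finite_inversions [simp]: "finite (inversions w)"
  by (metis affected_bounds finite_SigmaI finite_atLeastAtMost_int finite_subset inversions_bounded)

text \<open>Applying \<open>s i\<close> to both entries matches the inversions of \<open>w\<close>
  with those of \<open>w * s i\<close> other than \<open>(i, i + 1)\<close>, because
  \<open>s i\<close> reverses the order of no other pair.\<close>

lemma card_inversions_times_s:
  assumes "w \<langle>$\<rangle> i < w \<langle>$\<rangle> (i + 1)"
  shows "card (inversions (w * s i)) = Suc (card (inversions w))"
proof -
  let ?f = "map_prod (Perm.apply (s i)) (Perm.apply (s i))"
  have "inversions (w * s i) = insert (i, i + 1) (?f ` inversions w)"
  proof (intro equalityI subsetI)
    fix x assume "x \<in> inversions (w * s i)"
    then obtain a b where x: "x = (a, b)" "a < b" "(w * s i) \<langle>$\<rangle> b < (w * s i) \<langle>$\<rangle> a"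
      by (auto simp: inversions_def)
    show "x \<in> insert (i, i + 1) (?f ` inversions w)"
    proof (cases "x = (i, i + 1)")
      case False
      then have "s i \<langle>$\<rangle> a < s i \<langle>$\<rangle> b" using x by (auto simp: apply_s)
      then have "?f x \<in> inversions w" using x by (auto simp: inversions_def apply_times)
      moreover have "x = ?f (?f x)" by (simp add: x apply_s)
      ultimately show ?thesis by blast
    qed auto
  next
    fix x assume "x \<in> insert (i, i + 1) (?f ` inversions w)"
    then show "x \<in> inversions (w * s i)"
      using assms by (auto simp: inversions_def apply_times_s apply_s split: if_splits)
  qed
  moreover have "(i, i + 1) \<notin> ?f ` inversions w"
    by (auto simp: inversions_def apply_s split: if_splits)
  moreover have "inj_on ?f (inversions w)"
    by (rule inj_on_subset[OF prod.inj_map[OF bij_is_inj bij_is_inj]]) simp_all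
  ultimately show ?thesis by (simp add: card_image)
qed

lemma card_inversions_times_s':
  assumes "w \<langle>$\<rangle> (i + 1) < w \<langle>$\<rangle> i"
  shows "Suc (card (inversions (w * s i))) = card (inversions w)"
  using card_inversions_times_s[of "w * s i" i] assms by (simp add: apply_times_s)

text \<open>Without descents \<open>w\<close> is increasing, and then it sends its smallest moved
  integer below itself, although the image is again a moved integer.\<close>

lemma exists_descent:
  fixes w :: "int perm"
  assumes "w \<noteq> 1"
  shows "\<exists>i. w \<langle>$\<rangle> (i + 1) < w \<langle>$\<rangle> i"
proof (rule ccontr)
  assume "\<nexists>i. w \<langle>$\<rangle> (i + 1) < w \<langle>$\<rangle> i"
  then have step: "w \<langle>$\<rangle> i < w \<langle>$\<rangle> (i + 1)" for i
    using apply_neq_Suc[of w i] by (metis linorder_neqE)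
  have mono: "w \<langle>$\<rangle> i < w \<langle>$\<rangle> j" if "i < j" for i j
    using that by (induction j rule: int_gr_induct) (use step less_trans in blast)+
  define a where "a = Min (affected w)"
  have ne: "affected w \<noteq> {}" using assms by simp
  have a: "a \<in> affected w" "\<And>x. x \<in> affected w \<Longrightarrow> a \<le> x"
    unfolding a_def using ne by auto
  obtain j where j: "w \<langle>$\<rangle> j = a" by (metis bij_apply bij_pointE)
  have ja: "j \<in> affected w" using a j apply_affected[of w j] by simp
  then have "a < j" using a j by (metis in_affected order_le_less)
  then have "w \<langle>$\<rangle> a < a" using mono[of a j] j by simp
  then show False using a(1) a(2)[of "w \<langle>$\<rangle> a"] by simp
qed

lemma word_perm_Nil [simp]: "word_perm [] = 1"
  and word_perm_append [simp]: "word_perm (a @ b) = word_perm a * word_perm b"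
  and word_perm_Cons: "word_perm (i # a) = s i * word_perm a"
  by (simp_all add: word_perm_def)

lemma card_inversions_word_perm: "card (inversions (word_perm a)) \<le> length a"
proof (induction a rule: rev_induct)
  case (snoc i a)
  let ?w = "word_perm a"
  have "card (inversions (?w * s i)) \<le> Suc (card (inversions ?w))"
    using card_inversions_times_s[of ?w i] card_inversions_times_s'[of ?w i] apply_neq_Suc[of ?w i]
    by linarith
  then show ?case using snoc by (simp add: word_perm_Cons)
qed simp

lemma exists_word: "\<exists>a. word_perm a = w \<and> length a = card (inversions w)"
proof (induction "card (inversions w)" arbitrary: w rule: less_induct)
  case less
  show ?case
  proof (cases "w = 1")
    case True
    then show ?thesis by (intro exI[of _ "[]"]) simp
  next
    case False
    then obtain i where i: "w \<langle>$\<rangle> (i + 1) < w \<langle>$\<rangle> i" using exists_descent by blast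
    note c = card_inversions_times_s'[OF i]
    obtain a where "word_perm a = w * s i" "length a = card (inversions (w * s i))"
      using less[of "w * s i"] c by auto
    then show ?thesis using c by (intro exI[of _ "a @ [i]"]) (simp add: word_perm_Cons)
  qed
qed

text \<open>Each letter changes the inversion number by one, so no word is shorter; cancelling
  descents one at a time gives a word of exactly this length.\<close>

lemma len_eq_card_inversions: "len w = card (inversions w)"
  unfolding len_def
  by (rule Least_equality) (use exists_word[of w] card_inversions_word_perm in blast)+

lemma len_word_perm_le: "len (word_perm a) \<le> length a"
  by (simp add: len_eq_card_inversions card_inversions_word_perm)

lemma len_descent:
  "w \<langle>$\<rangle> (i + 1) < w \<langle>$\<rangle> i \<Longrightarrow> len w = Suc (len (w * s i))"
  by (simp add: len_eq_card_inversions card_inversions_times_s')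

lemma len_ascent:
  "w \<langle>$\<rangle> i < w \<langle>$\<rangle> (i + 1) \<Longrightarrow> len (w * s i) = Suc (len w)"
  by (simp add: len_eq_card_inversions card_inversions_times_s)

lemma descent_iff: "len (w * s i) < len w \<longleftrightarrow> w \<langle>$\<rangle> (i + 1) < w \<langle>$\<rangle> i"
  using len_descent[of w i] len_ascent[of w i] apply_neq_Suc[of w i] by linarith

lemma len_1 [simp]: "len 1 = 0"
  by (simp add: len_eq_card_inversions)

lemma len_eq_0_iff: "len w = 0 \<longleftrightarrow> w = 1"
  using exists_word[of w] by (auto simp flip: len_eq_card_inversions)

section \<open>Reduced words by their last letter\<close>

lemma Nil_in_reduced_words: "[] \<in> reduced_words w \<longleftrightarrow> w = 1"
  by (auto simp: reduced_words_def)

text \<open>This recursion has the same shape as \<open>nil_mult\<close>: it strips a descent on the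
  right. The later inductions over reduced words rest on it.\<close>

lemma snoc_in_reduced_words:
  "a @ [i] \<in> reduced_words w \<longleftrightarrow> w \<langle>$\<rangle> (i + 1) < w \<langle>$\<rangle> i \<and> a \<in> reduced_words (w * s i)"
proof
  assume "a @ [i] \<in> reduced_words w"
  then have w: "word_perm a * s i = w" "Suc (length a) = len w"
    by (auto simp: reduced_words_def word_perm_Cons)
  then have a: "word_perm a = w * s i" by auto
  then have "len (w * s i) \<le> length a" using len_word_perm_le[of a] by simp
  then have "w \<langle>$\<rangle> (i + 1) < w \<langle>$\<rangle> i" using w descent_iff[of w i] by simp
  then show "w \<langle>$\<rangle> (i + 1) < w \<langle>$\<rangle> i \<and> a \<in> reduced_words (w * s i)"
    using a w len_descent[of w i] by (simp add: reduced_words_def)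
qed (auto simp: reduced_words_def word_perm_Cons len_descent)

text \<open>The letter before the last is a descent of \<open>w * s i\<close>, whereas
  \<open>i\<close> is not. In \<open>compatible_seqs_iff\<close> this excludes the one case that the
  conditions on compatible sequences leave open.\<close>

lemma distinct_adj_reduced_word: "a \<in> reduced_words w \<Longrightarrow> distinct_adj a"
proof (induction a arbitrary: w rule: rev_induct)
  case (snoc i a)
  then have i: "w \<langle>$\<rangle> (i + 1) < w \<langle>$\<rangle> i" "a \<in> reduced_words (w * s i)" "distinct_adj a"
    by (auto simp: snoc_in_reduced_words)
  show ?case
  proof (cases a rule: rev_cases)
    case (snoc a' j)
    then have "(w * s i) \<langle>$\<rangle> (j + 1) < (w * s i) \<langle>$\<rangle> j"
      using i by (simp add: snoc_in_reduced_words)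
    then have "j \<noteq> i" using i by (auto simp: apply_times_s)
    then show ?thesis using i snoc by (simp add: distinct_adj_append_iff)
  qed simp
qed simp

lemma descent_bounds:
  fixes w :: "int perm"
  assumes "affected w \<subseteq> {p..q}" "w \<langle>$\<rangle> (i + 1) < w \<langle>$\<rangle> i"
  shows "p \<le> i" "i < q"
proof -
  have "(i, i + 1) \<in> inversions w" using assms by (simp add: inversions_def)
  then show "p \<le> i" "i < q" using inversions_bounded[OF assms(1)] by auto
qed

lemma affected_times_s:
  fixes w :: "int perm"
  assumes "affected w \<subseteq> {p..q}" "p \<le> i" "i < q"
  shows "affected (w * s i) \<subseteq> {p..q}"
proof -
  have "affected (s i) = {i, i + 1}" by (simp add: s_def affected_swap)
  then show ?thesis using affected_times[of w "s i"] assms by auto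
qed

lemma reduced_word_bounds:
  "affected w \<subseteq> {p..q} \<Longrightarrow> a \<in> reduced_words w \<Longrightarrow> set a \<subseteq> {p..<q}"
proof (induction a arbitrary: w rule: rev_induct)
  case (snoc i a)
  then have "w \<langle>$\<rangle> (i + 1) < w \<langle>$\<rangle> i" "a \<in> reduced_words (w * s i)"
    by (auto simp: snoc_in_reduced_words)
  moreover from this have "p \<le> i" "i < q" using descent_bounds snoc by blast+
  ultimately show ?case using snoc affected_times_s[of w p q i] by auto
qed simp

lemma finite_reduced_words [simp]: "finite (reduced_words w)"
proof -
  obtain p q where "affected w \<subseteq> {p..q}" by (rule affected_bounds)
  then have "reduced_words w \<subseteq> {a. set a \<subseteq> {p..<q} \<and> length a = len w}"
    using reduced_word_bounds[of w p q] by (auto simp: reduced_words_def subset_iff)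
  then show ?thesis by (rule finite_subset) (simp add: finite_lists_length_eq)
qed

section \<open>Formal power series and divided differences\<close>

lemma coeff_0 [simp]: "coeff 0 M = 0"
  and coeff_1: "coeff 1 M = (if M = {#} then 1 else 0)"
  and coeff_add [simp]: "coeff (f + g) M = coeff f M + coeff g M"
  and coeff_diff [simp]: "coeff (f - g) M = coeff f M - coeff g M"
  and coeff_mult: "coeff (f * g) M = (\<Sum>(A, B) | A + B = M. coeff f A * coeff g B)"
  and coeff_mvar: "coeff (mvar v) M = (if M = {#v#} then 1 else 0)"
  and coeff_Abs_mfps [simp]: "coeff (Abs_mfps h) = h"
  for f g :: "('v, 'a::comm_ring_1) mfps"
  by (simp_all add: zero_mfps.rep_eq one_mfps.rep_eq plus_mfps.rep_eq minus_mfps.rep_eq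
      times_mfps.rep_eq mvar.rep_eq Abs_mfps_inverse)

lemma coeff_sum: "coeff (sum f A) M = (\<Sum>x\<in>A. coeff (f x) M)"
  for f :: "_ \<Rightarrow> ('v, 'a::comm_ring_1) mfps"
  by (induction A rule: infinite_finite_induct) auto

lemma coeff_mvar_mult:
  "coeff (mvar v * f) M = (if v \<in># M then coeff f (M - {#v#}) else 0)"
  for f :: "('v, 'a::comm_ring_1) mfps"
proof -
  have "coeff (mvar v * f) M
      = (\<Sum>(A, B) \<in> (if v \<in># M then {({#v#}, M - {#v#})} else {}). coeff (mvar v) A * coeff f B)"
    unfolding coeff_mult by (rule sum.mono_neutral_right) (auto simp: coeff_mvar split: if_splits)
  then show ?thesis by (simp add: coeff_mvar)
qed

lemma coeff_monomial:
  "coeff (prod_list (map mvar b)) M = (if mset b = M then 1 else 0 :: 'a::comm_ring_1)"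
proof (induction b arbitrary: M)
  case (Cons v b)
  have "mset b = M - {#v#} \<longleftrightarrow> mset (v # b) = M" if "v \<in># M"
    using that by (metis add_mset_remove_trivial insert_DiffM mset.simps(2))
  moreover have "mset (v # b) \<noteq> M" if "v \<notin># M" using that by auto
  ultimately show ?case using Cons by (simp add: coeff_mvar_mult)
qed (auto simp: coeff_1)

lemma coeff_rename [simp]: "coeff (rename \<sigma> f) M = coeff f (image_mset (inv \<sigma>) M)"
  by (simp add: rename.rep_eq)

lemma rename_add: "rename \<sigma> (f + g) = rename \<sigma> f + rename \<sigma> g"
  and rename_diff: "rename \<sigma> (f - g) = rename \<sigma> f - rename \<sigma> g"
  and rename_0 [simp]: "rename \<sigma> 0 = 0"
  and rename_1 [simp]: "rename \<sigma> 1 = 1"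
  for f g :: "('v, 'a::comm_ring_1) mfps"
  by (rule mfps_eqI; simp add: coeff_1)+

text \<open>Comparing coefficients at \<open>add_mset u M\<close> shows that the coefficient of
  \<open>g - h\<close> at \<open>M\<close> is zero or equals one at a monomial with smaller exponent
  of \<open>v\<close>; hence the induction on \<open>count M v\<close>.\<close>

lemma linear_factor_cancel:
  fixes g h :: "('v, 'a::comm_ring_1) mfps"
  assumes eq: "(mvar u - mvar v) * g = (mvar u - mvar v) * h" and "u \<noteq> v"
  shows "g = h"
proof -
  have eq': "mvar u * (g - h) = mvar v * (g - h)"
    using eq by (simp add: algebra_simps)
  have "coeff (g - h) M = 0" for M
  proof (induction "count M v" arbitrary: M)
    case 0
    then have "v \<notin># M" by (simp add: not_in_iff)
    then show ?case
      using arg_cong[OF eq', of "\<lambda>f. coeff f (add_mset u M)"] \<open>u \<noteq> v\<close>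
      by (simp add: coeff_mvar_mult)
  next
    case (Suc n)
    then have v: "v \<in># M" by (metis count_inI nat.simps(3))
    have "coeff (g - h) (add_mset u M - {#v#}) = 0"
      using Suc \<open>u \<noteq> v\<close> by (intro Suc(1)) auto
    then show ?case
      using arg_cong[OF eq', of "\<lambda>f. coeff f (add_mset u M)"] v
      by (simp add: coeff_mvar_mult)
  qed
  then have "g - h = 0" by (intro mfps_eqI) simp
  then show ?thesis by simp
qed

lemma divdiff_eqI:
  assumes "(mvar i - mvar (i + 1)) * g = f - rename (Perm.apply (s i)) f"
  shows "divdiff i f = g"
  unfolding divdiff_def
proof (rule the_equality)
  fix h assume "(mvar i - mvar (i + 1)) * h = f - rename (Perm.apply (s i)) f"
  with assms have "(mvar i - mvar (i + 1)) * h = (mvar i - mvar (i + 1)) * g" by (simp only:)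
  then show "h = g" by (rule linear_factor_cancel) simp
qed (fact assms)

lemma sum_antisymmetric_eq_0:
  fixes h :: "nat \<Rightarrow> rat"
  assumes "\<And>j. j \<le> d \<Longrightarrow> h (d - j) = - h j"
  shows "(\<Sum>j\<le>d. h j) = 0"
proof -
  have "(\<Sum>j\<le>d. h j) = (\<Sum>j\<le>d. h (d - j))"
    by (rule sum.reindex_bij_witness[of _ "\<lambda>j. d - j" "\<lambda>j. d - j"]) auto
  also have "\<dots> = - (\<Sum>j\<le>d. h j)" using assms by (simp add: sum_negf)
  finally show ?thesis by simp
qed

text \<open>
  Along each antidiagonal of exponents of \<open>x\<^sub>i\<close> and \<open>x\<^bsub>i+1\<^esub>\<close> the quotient is
  minus a partial sum of the coefficients of the antisymmetric series \<open>f - s\<^sub>i f\<close>.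
\<close>

lemma exists_divided_difference:
  "\<exists>g. (mvar i - mvar (i + 1)) * g = f - rename (Perm.apply (s i)) (f :: (int, rat) mfps)"
proof -
  define h where "h = f - rename (Perm.apply (s i)) f"
  define mon where "mon R a b = R + replicate_mset a i + replicate_mset b (i + 1)"
    for R :: "int multiset" and a b
  define rest where "rest M = filter_mset (\<lambda>x. x \<noteq> i \<and> x \<noteq> i + 1) M" for M :: "int multiset"
  \<comment> \<open>The quotient has degree one less than \<open>h\<close>, so its coefficient at
    exponents \<open>a\<close> and \<open>b\<close> is taken along the antidiagonal of total
    \<open>Suc (a + b)\<close>.\<close>
  define q where "q R a b = - (\<Sum>j\<le>a. coeff h (mon R j (Suc (a + b) - j)))" for R a b
  define g where "g = Abs_mfps (\<lambda>M. q (rest M) (count M i) (count M (i + 1)))"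
  have split: "M = mon (rest M) (count M i) (count M (i + 1))" for M
    by (rule multiset_eqI) (auto simp: mon_def rest_def not_in_iff)
  have anti: "coeff h (mon R b a) = - coeff h (mon R a b)" if "R = rest M" for R M a b
  proof -
    have "image_mset (Perm.apply (s i)) R = R"
      unfolding that rest_def by (induction M) (auto simp: apply_s)
    then have "image_mset (Perm.apply (s i)) (mon R c d) = mon R d c" for c d
      by (simp add: mon_def apply_s algebra_simps)
    then show ?thesis by (simp add: h_def)
  qed
  have "coeff ((mvar i - mvar (i + 1)) * g) M = coeff h M" for M
  proof -
    define R a b where "R = rest M" and "a = count M i" and "b = count M (i + 1)"
    have M: "coeff h M = coeff h (mon R a b)" unfolding R_def a_def b_def by (simp flip: split)
    have cnt: "i \<in># M \<longleftrightarrow> a > 0" "i + 1 \<in># M \<longleftrightarrow> b > 0"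
      by (simp_all add: a_def b_def)
    have rest: "rest (M - {#i#}) = R" "rest (M - {#i + 1#}) = R"
      unfolding R_def rest_def by (rule multiset_eqI, auto)+
    have l: "coeff (mvar i * g) M = (if a > 0 then q R (a - 1) b else 0)"
      by (simp add: coeff_mvar_mult cnt g_def rest) (simp add: a_def b_def)
    have r: "coeff (mvar (i + 1) * g) M = (if b > 0 then q R a (b - 1) else 0)"
      by (simp add: coeff_mvar_mult cnt g_def rest) (simp add: a_def b_def)
    \<comment> \<open>The total along an antidiagonal vanishes. This settles the boundary cases with
      \<open>b = 0\<close>, where no second partial sum is available to subtract.\<close>
    have z: "(\<Sum>j\<le>d. coeff h (mon R j (d - j))) = 0" for d
    proof (rule sum_antisymmetric_eq_0)
      fix j assume "j \<le> d"
      then show "coeff h (mon R (d - j) (d - (d - j))) = - coeff h (mon R j (d - j))"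
        using anti[OF R_def, of "d - j" j] by simp
    qed
    have "coeff (mvar i * g) M - coeff (mvar (i + 1) * g) M = coeff h (mon R a b)"
    proof (cases a)
      case 0
      then show ?thesis using z[of 0] by (cases b) (auto simp: l r q_def)
    next
      case (Suc a')
      show ?thesis
      proof (cases b)
        case 0
        then show ?thesis using Suc z[of a] by (simp add: l r q_def)
      next
        case (Suc b')
        then show ?thesis using \<open>a = Suc a'\<close> by (simp add: l r q_def)
      qed
    qed
    then show ?thesis using M by (simp add: left_diff_distrib)
  qed
  then show ?thesis unfolding h_def[symmetric] by (intro exI[of _ g] mfps_eqI)
qed

lemma divdiff_spec:
  "(mvar i - mvar (i + 1)) * divdiff i f = f - rename (Perm.apply (s i)) f"
  using exists_divided_difference[of i f] divdiff_eqI[of i _ f] by auto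

lemma divdiff_0 [simp]: "divdiff i 0 = 0"
  by (rule divdiff_eqI) simp

section \<open>The right regular action of the nilCoxeter algebra\<close>

text \<open>
  A function \<open>\<phi>\<close> stands for the element \<open>\<Sum>\<^sub>w \<phi> w u\<^sub>w\<close> of the nilCoxeter algebra;
  \<open>nil_mult i\<close> is right multiplication by \<open>u\<^sub>i\<close> and \<open>nil_exp i x\<close> is right multiplication by
  \<open>exp (x u\<^sub>i) = 1 + x u\<^sub>i\<close>. Products of algebra elements therefore appear in reversed order.
\<close>

definition nil_mult :: "int \<Rightarrow> (int perm \<Rightarrow> 'r::comm_ring_1) \<Rightarrow> int perm \<Rightarrow> 'r" where
  "nil_mult i \<phi> w = (if w \<langle>$\<rangle> (i + 1) < w \<langle>$\<rangle> i then \<phi> (w * s i) else 0)"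

definition nil_exp :: "int \<Rightarrow> 'r \<Rightarrow> (int perm \<Rightarrow> 'r::comm_ring_1) \<Rightarrow> int perm \<Rightarrow> 'r" where
  "nil_exp i x \<phi> w = \<phi> w + x * nil_mult i \<phi> w"

lemma s_commute: "i + 1 < j \<or> j + 1 < i \<Longrightarrow> w * s i * s j = w * s j * s i"
  by (rule perm_eqI) (auto simp: apply_times apply_s)

lemma s_braid: "w * s i * s (i + 1) * s i = w * s (i + 1) * s i * s (i + 1)"
  by (rule perm_eqI) (auto simp: apply_times apply_s)

lemma nil_mult_commute:
  "i + 1 < j \<or> j + 1 < i \<Longrightarrow> nil_mult i (nil_mult j \<phi>) = nil_mult j (nil_mult i \<phi>)"
  by (rule ext) (auto simp: nil_mult_def apply_times_s s_commute)

lemma nil_mult_twice: "nil_mult i (nil_mult i \<phi>) = (\<lambda>_. 0)"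
  by (rule ext) (auto simp: nil_mult_def apply_times_s)

lemma nil_mult_braid:
  "nil_mult i (nil_mult (i + 1) (nil_mult i \<phi>))
    = nil_mult (i + 1) (nil_mult i (nil_mult (i + 1) \<phi>))"
  by (rule ext) (auto simp: nil_mult_def apply_times_s s_braid add.assoc)

lemma nil_mult_add: "nil_mult i (\<lambda>w. \<phi> w + \<psi> w) = (\<lambda>w. nil_mult i \<phi> w + nil_mult i \<psi> w)"
  and nil_mult_scale: "nil_mult i (\<lambda>w. c * \<phi> w) = (\<lambda>w. c * nil_mult i \<phi> w)"
  and nil_mult_0: "nil_mult i (\<lambda>w. 0 :: 'a) = (\<lambda>w. 0)"
  for \<phi> \<psi> :: "int perm \<Rightarrow> 'a::comm_ring_1"
  by (auto simp: nil_mult_def)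

lemma nil_exp_eq: "nil_exp i x \<phi> = (\<lambda>w. \<phi> w + x * nil_mult i \<phi> w)"
  by (rule ext) (simp add: nil_exp_def)

lemmas nil_simps = nil_exp_eq nil_mult_add nil_mult_scale nil_mult_0 nil_mult_twice

lemma nil_exp_0 [simp]: "nil_exp i 0 \<phi> = \<phi>"
  by (rule ext) (simp add: nil_exp_def)

lemma nil_exp_add: "nil_exp i x (nil_exp i y \<phi>) = nil_exp i (x + y) \<phi>"
  by (rule ext) (simp add: nil_simps algebra_simps)

lemma nil_mult_nil_exp_same: "nil_mult i (nil_exp i x \<phi>) = nil_mult i \<phi>"
  by (simp add: nil_simps)

lemma nil_exp_commute:
  assumes "i + 1 < j \<or> j + 1 < i"
  shows "nil_exp i x (nil_exp j y \<phi>) = nil_exp j y (nil_exp i x \<phi>)"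
  by (rule ext) (simp add: nil_simps nil_mult_commute[OF assms] algebra_simps)

text \<open>After expansion the cubic terms agree by the braid relation; the square of
  \<open>u_i\<close> vanishes, and the middle parameter \<open>x + y\<close> makes the linear and
  quadratic terms match.\<close>

lemma yang_baxter:
  "nil_exp i x (nil_exp (i + 1) (x + y) (nil_exp i y \<phi>))
    = nil_exp (i + 1) y (nil_exp i (x + y) (nil_exp (i + 1) x \<phi>))"
  by (rule ext) (simp add: nil_simps nil_mult_braid[of i \<phi>, unfolded add.commute[of i 1]] algebra_simps)

text \<open>Split \<open>y\<close> as \<open>x + (y - x)\<close>, apply \<open>yang_baxter\<close>
  with parameters \<open>y - x\<close> and \<open>x\<close>, and merge \<open>y - x\<close> with
  \<open>- y\<close>. This exchanges \<open>x\<close> and \<open>y\<close> at the place where two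
  rows start.\<close>

lemma yang_baxter_symmetric:
  "nil_exp i y (nil_exp (i + 1) y (nil_exp i x (nil_exp (i + 1) (- y) \<phi>)))
    = nil_exp i x (nil_exp (i + 1) x (nil_exp i y (nil_exp (i + 1) (- x) \<phi>)))"
proof -
  let ?\<chi> = "nil_exp (i + 1) (- y) \<phi>"
  have "nil_exp i y (nil_exp (i + 1) y (nil_exp i x ?\<chi>))
      = nil_exp i x (nil_exp i (y - x) (nil_exp (i + 1) y (nil_exp i x ?\<chi>)))"
    by (simp add: nil_exp_add)
  also have "\<dots> = nil_exp i x (nil_exp (i + 1) x (nil_exp i y (nil_exp (i + 1) (y - x) ?\<chi>)))"
    using yang_baxter[of i "y - x" x ?\<chi>] by simp
  finally show ?thesis by (simp add: nil_exp_add)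
qed

text \<open>\<open>nil_row m k x\<close> is right multiplication by \<open>(1 + x u\<^bsub>k+m-1\<^esub>) \<cdots> (1 + x u\<^bsub>k+1\<^esub>) (1 + x u\<^sub>k)\<close>.\<close>

primrec nil_row :: "nat \<Rightarrow> int \<Rightarrow> 'r \<Rightarrow> (int perm \<Rightarrow> 'r::comm_ring_1) \<Rightarrow> int perm \<Rightarrow> 'r" where
  "nil_row 0 k x \<phi> = \<phi>"
| "nil_row (Suc m) k x \<phi> = nil_exp k x (nil_row m (k + 1) x \<phi>)"

lemma nil_row_nil_exp_commute:
  "i + 1 < k \<Longrightarrow> nil_row m k x (nil_exp i y \<phi>) = nil_exp i y (nil_row m k x \<phi>)"
proof (induction m arbitrary: k)
  case (Suc m)
  then show ?case using nil_exp_commute[of k i] by simp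
qed simp

lemma nil_row_commute: "nil_row m k y (nil_row m k x \<phi>) = nil_row m k x (nil_row m k y \<phi>)"
proof (induction m arbitrary: k)
  case (Suc m)
  show ?case
  proof (cases m)
    case 0
    then show ?thesis by (simp add: nil_exp_add add.commute)
  next
    case (Suc m')
    \<comment> \<open>Beyond \<open>k + 1\<close> the row in \<open>y\<close> commutes with
      \<open>nil_exp k x\<close>. Inserting \<open>nil_exp (k + 1) (- y)\<close> completes that
      remainder again to a whole row from \<open>k + 1\<close>, to which the induction hypothesis
      applies.\<close>
    have "nil_row (Suc m) k y (nil_row (Suc m) k x \<phi>)
        = nil_exp k y (nil_exp (k + 1) y (nil_exp k x (nil_exp (k + 1) (- y)
            (nil_row m (k + 1) y (nil_row m (k + 1) x \<phi>)))))" for x y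
      by (simp add: Suc nil_row_nil_exp_commute nil_exp_add)
    then show ?thesis using Suc.IH[of "k + 1"] yang_baxter_symmetric[of k] by simp
  qed
qed simp

text \<open>All rows end at the same generator, so their lengths fall from \<open>n\<close> to 1.
  This finite part of the infinite product from row \<open>k\<close> on suffices for
  \<open>w\<close> moving nothing above \<open>k + int n\<close>.\<close>

primrec nil_product ::
    "nat \<Rightarrow> int \<Rightarrow> (int perm \<Rightarrow> (int, rat) mfps) \<Rightarrow> int perm \<Rightarrow> (int, rat) mfps" where
  "nil_product 0 k \<phi> = \<phi>"
| "nil_product (Suc n) k \<phi> = nil_product n (k + 1) (nil_row (Suc n) k (mvar k) \<phi>)"

definition nil_one :: "int perm \<Rightarrow> 'r::comm_ring_1" where
  "nil_one w = (if w = 1 then 1 else 0)"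

section \<open>Divided differences of the product\<close>

lemma rename_nil_mult: "rename \<sigma> (nil_mult i \<phi> w) = nil_mult i (\<lambda>v. rename \<sigma> (\<phi> v)) w"
  by (simp add: nil_mult_def)

lemma rename_nil_exp:
  "bij \<sigma> \<Longrightarrow>
    rename \<sigma> (nil_exp i x \<phi> w) = nil_exp i (rename \<sigma> x) (\<lambda>v. rename \<sigma> (\<phi> v)) w"
  by (simp add: nil_exp_def rename_add rename_mult rename_nil_mult)

lemma rename_nil_row:
  assumes "bij \<sigma>"
  shows "rename \<sigma> (nil_row m k x \<phi> w) = nil_row m k (rename \<sigma> x) (\<lambda>v. rename \<sigma> (\<phi> v)) w"
proof (induction m arbitrary: k w)
  case (Suc m)
  then have "(\<lambda>v. rename \<sigma> (nil_row m (k + 1) x \<phi> v))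
      = nil_row m (k + 1) (rename \<sigma> x) (\<lambda>v. rename \<sigma> (\<phi> v))" by blast
  then show ?case using assms by (simp add: rename_nil_exp)
qed simp

text \<open>The claim that \<open>A_i\<close> acts as right multiplication by \<open>u_i\<close>,
  with the denominator cleared so that it can be carried through further factors.\<close>

definition divided_by_nil_mult :: "int \<Rightarrow> (int perm \<Rightarrow> (int, rat) mfps) \<Rightarrow> bool" where
  "divided_by_nil_mult i \<psi> \<longleftrightarrow>
    (\<forall>w. \<psi> w - rename (Perm.apply (s i)) (\<psi> w) = (mvar i - mvar (i + 1)) * nil_mult i \<psi> w)"

text \<open>The generators \<open>u_i\<close> and \<open>u_j\<close> commute and \<open>z\<close> is
  invariant under \<open>s i\<close>, so the factor passes through both sides of the
  relation.\<close>

lemma divided_by_nil_mult_nil_exp: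
  assumes "divided_by_nil_mult i \<psi>" "i + 1 < j" "rename (Perm.apply (s i)) z = z"
  shows "divided_by_nil_mult i (nil_exp j z \<psi>)"
  unfolding divided_by_nil_mult_def
proof
  fix w
  let ?r = "rename (Perm.apply (s i))" and ?c = "mvar i - mvar (i + 1) :: (int, rat) mfps"
  have d: "\<psi> v - ?r (\<psi> v) = ?c * nil_mult i \<psi> v" for v
    using assms by (simp add: divided_by_nil_mult_def)
  have "nil_exp j z \<psi> w - ?r (nil_exp j z \<psi> w)
      = (\<psi> w - ?r (\<psi> w)) + z * (nil_mult j \<psi> w - nil_mult j (\<lambda>v. ?r (\<psi> v)) w)"
    using assms
    by (simp add: rename_nil_exp nil_exp_def rename_add rename_mult rename_nil_mult algebra_simps)
  also have "nil_mult j \<psi> w - nil_mult j (\<lambda>v. ?r (\<psi> v)) w = nil_mult j (\<lambda>v. \<psi> v - ?r (\<psi> v)) w"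
    by (simp add: nil_mult_def)
  also have "\<dots> = ?c * nil_mult i (nil_mult j \<psi>) w"
    using assms by (simp add: d nil_mult_scale nil_mult_commute)
  also have "(\<psi> w - ?r (\<psi> w)) + z * (?c * nil_mult i (nil_mult j \<psi>) w)
      = ?c * nil_mult i (nil_exp j z \<psi>) w"
    unfolding d by (simp add: nil_simps algebra_simps)
  finally show "nil_exp j z \<psi> w - ?r (nil_exp j z \<psi> w) = ?c * nil_mult i (nil_exp j z \<psi>) w" .
qed

lemma divided_by_nil_mult_nil_row:
  "divided_by_nil_mult i \<psi> \<Longrightarrow> i + 1 < k \<Longrightarrow> rename (Perm.apply (s i)) z = z \<Longrightarrow>
    divided_by_nil_mult i (nil_row m k z \<psi>)"
  by (induction m arbitrary: k) (auto intro!: divided_by_nil_mult_nil_exp)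

lemma rename_s_mvar: "k \<noteq> i \<Longrightarrow> k \<noteq> i + 1 \<Longrightarrow> rename (Perm.apply (s i)) (mvar k) = mvar k"
  by (simp add: rename_mvar apply_s)

lemma divided_by_nil_mult_nil_product:
  "divided_by_nil_mult i \<psi> \<Longrightarrow> i + 1 < k \<Longrightarrow> divided_by_nil_mult i (nil_product n k \<psi>)"
proof (induction n arbitrary: k \<psi>)
  case (Suc n)
  have "divided_by_nil_mult i (nil_row (Suc n) k (mvar k) \<psi>)"
    using Suc.prems by (intro divided_by_nil_mult_nil_row rename_s_mvar) auto
  then show ?case using Suc.prems by (simp add: Suc.IH del: nil_row.simps)
qed simp

text \<open>If the second row also started at \<open>i\<close>, the product \<theta> would be
  symmetric in \<open>mvar i\<close> and \<open>mvar (i + 1)\<close> by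
  \<open>nil_row_commute\<close>. The missing factor is the only asymmetry, and its inverse is
  linear in the variable, which leaves the quotient \<open>nil_mult i\<close> \<theta>.\<close>

lemma divided_by_nil_mult_two_rows:
  fixes \<phi> :: "int perm \<Rightarrow> (int, rat) mfps"
  assumes "\<And>w. rename (Perm.apply (s i)) (\<phi> w) = \<phi> w"
  shows "divided_by_nil_mult i (nil_row m (i + 1) (mvar (i + 1)) (nil_row (Suc m) i (mvar i) \<phi>))"
proof -
  let ?r = "rename (Perm.apply (s i))"
  define x y where "x = (mvar i :: (int, rat) mfps)" and "y = (mvar (i + 1) :: (int, rat) mfps)"
  define \<psi> where "\<psi> x y = nil_row m (i + 1) y (nil_row (Suc m) i x \<phi>)" for x y
  define \<theta> where "\<theta> = nil_row (Suc m) i y (nil_row (Suc m) i x \<phi>)"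
  have \<theta>: "\<theta> = nil_exp i y (\<psi> x y)" "\<theta> = nil_exp i x (\<psi> y x)"
    unfolding \<theta>_def \<psi>_def by (simp, subst nil_row_commute, simp)
  have \<psi>: "\<psi> x y = nil_exp i (- y) \<theta>"
    unfolding \<theta>(1) by (simp add: nil_exp_add)
  have \<psi>': "\<psi> y x = nil_exp i (- x) \<theta>"
    unfolding \<theta>(2) by (simp add: nil_exp_add)
  have "?r x = y" "?r y = x" by (simp_all add: x_def y_def rename_mvar apply_s)
  then have r: "?r (\<psi> x y w) = \<psi> y x w" for w
    unfolding \<psi>_def by (simp add: rename_nil_row assms del: nil_row.simps)
  have "\<psi> x y w - ?r (\<psi> x y w) = (x - y) * nil_mult i \<theta> w" for w
    unfolding r unfolding \<psi> \<psi>' by (simp add: nil_exp_def algebra_simps)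
  moreover have "nil_mult i \<theta> = nil_mult i (\<psi> x y)"
    unfolding \<theta>(1) by (simp add: nil_mult_nil_exp_same)
  ultimately show ?thesis
    unfolding divided_by_nil_mult_def \<psi>_def x_def y_def by simp
qed

text \<open>Rows before \<open>i\<close> keep the argument invariant under \<open>s i\<close>, rows
  \<open>i\<close> and \<open>i + 1\<close> together produce the relation, and all later rows
  preserve it.\<close>

lemma divided_by_nil_mult_nil_product_invariant:
  assumes "\<And>w. rename (Perm.apply (s i)) (\<phi> w) = \<phi> w" "p \<le> i" "i + 1 < p + int n"
  shows "divided_by_nil_mult i (nil_product n p \<phi>)"
  using assms
proof (induction n arbitrary: p \<phi>)
  case (Suc n)
  show ?case
  proof (cases "p = i")
    case False
    then have "rename (Perm.apply (s i)) (nil_row (Suc n) p (mvar p) \<phi> w)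
        = nil_row (Suc n) p (mvar p) \<phi> w" for w
      using Suc.prems by (simp add: rename_nil_row rename_s_mvar del: nil_row.simps)
    then show ?thesis using Suc.prems False by (simp add: Suc.IH del: nil_row.simps)
  next
    case True
    then obtain m where "n = Suc m" using Suc.prems by (cases n) auto
    then show ?thesis
      using True divided_by_nil_mult_nil_product[OF
          divided_by_nil_mult_two_rows[OF Suc.prems(1), where m = n], of "i + 2" m]
      by (simp add: add.assoc del: nil_row.simps)
  qed
qed simp

section \<open>Monomial expansion\<close>

primrec row_factors :: "nat \<Rightarrow> int \<Rightarrow> int \<Rightarrow> (int \<times> int) list" where
  "row_factors 0 k b = []"
| "row_factors (Suc m) k b = row_factors m (k + 1) b @ [(k, b)]"

text \<open>The pairs \<open>(i, b)\<close> of the factors \<open>1 + x\<^sub>b u\<^sub>i\<close> of \<^const>\<open>nil_product\<close>, from left to right.\<close>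

primrec factors :: "nat \<Rightarrow> int \<Rightarrow> (int \<times> int) list" where
  "factors 0 k = []"
| "factors (Suc n) k = row_factors (Suc n) k k @ factors n (k + 1)"

abbreviation apply_factors ::
    "(int \<times> int) list \<Rightarrow> (int perm \<Rightarrow> (int, rat) mfps) \<Rightarrow> int perm \<Rightarrow> (int, rat) mfps" where
  "apply_factors \<equiv> fold (\<lambda>(i, b). nil_exp i (mvar b))"

lemma nil_row_eq: "nil_row m k (mvar b) \<phi> = apply_factors (row_factors m k b) \<phi>"
  by (induction m arbitrary: k) auto

lemma nil_product_eq: "nil_product n k \<phi> = apply_factors (factors n k) \<phi>"
  by (induction n arbitrary: k \<phi>) (auto simp del: nil_row.simps row_factors.simps simp: nil_row_eq)

text \<open>The order in which \<open>factors\<close> lists its pairs: row by row, with decreasing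
  generators inside a row.\<close>

definition before :: "int \<times> int \<Rightarrow> int \<times> int \<Rightarrow> bool" where
  "before x y \<longleftrightarrow> snd x < snd y \<or> snd x = snd y \<and> fst y < fst x"

lemma set_row_factors: "set (row_factors m k b) = {k..<k + int m} \<times> {b}"
  by (induction m arbitrary: k) auto

lemma set_factors: "set (factors n k) = {(i, b). k \<le> b \<and> b \<le> i \<and> i < k + int n}"
proof (induction n arbitrary: k)
  case (Suc n)
  have "set (factors (Suc n) k)
      = {k..<k + int (Suc n)} \<times> {k} \<union> {(i, b). k + 1 \<le> b \<and> b \<le> i \<and> i < k + 1 + int n}"
    by (simp add: Suc set_row_factors del: row_factors.simps)
  moreover have "i \<in> {k..<k + int (Suc n)} \<and> b = k \<or> k + 1 \<le> b \<and> b \<le> i \<and> i < k + 1 + int n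
      \<longleftrightarrow> k \<le> b \<and> b \<le> i \<and> i < k + int (Suc n)" for i b
    unfolding atLeastLessThan_iff of_nat_Suc by presburger
  ultimately show ?case by blast
qed auto

lemma sorted_row_factors: "sorted_wrt before (row_factors m k b)"
  by (induction m arbitrary: k) (auto simp: sorted_wrt_append set_row_factors before_def)

lemma sorted_factors: "sorted_wrt before (factors n k)"
  by (induction n arbitrary: k)
    (auto simp: sorted_wrt_append set_row_factors set_factors sorted_row_factors before_def
      simp del: row_factors.simps)

lemma sorted_before_distinct: "sorted_wrt before cs \<Longrightarrow> distinct cs"
  by (induction cs) (auto simp: before_def)

text \<open>When \<open>cs\<close> is itself sorted by the strict order \<open>before\<close>, a
  sorted list of its entries is exactly a subword, so positions need not be recorded.\<close>

definition reduced_subwords :: "(int \<times> int) list \<Rightarrow> int perm \<Rightarrow> (int \<times> int) list set" where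
  "reduced_subwords cs w =
    {C. sorted_wrt before C \<and> set C \<subseteq> set cs \<and> map fst C \<in> reduced_words w}"

lemma finite_reduced_subwords [simp]: "finite (reduced_subwords cs w)"
proof (rule finite_subset)
  show "reduced_subwords cs w \<subseteq> {C. set C \<subseteq> set cs \<and> length C = len w}"
    by (auto simp: reduced_subwords_def reduced_words_def)
qed (simp add: finite_lists_length_eq)

lemma reduced_subwords_Nil: "reduced_subwords [] w = (if w = 1 then {[]} else {})"
  by (auto simp: reduced_subwords_def Nil_in_reduced_words)

text \<open>The pair \<open>(i, b)\<close> comes after all others, so a subword either avoids it or
  ends with it.\<close>

lemma reduced_subwords_snoc:
  assumes "sorted_wrt before (cs @ [(i, b)])"
  shows "reduced_subwords (cs @ [(i, b)]) w = reduced_subwords cs w \<union>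
    (if w \<langle>$\<rangle> (i + 1) < w \<langle>$\<rangle> i then (\<lambda>C. C @ [(i, b)]) ` reduced_subwords cs (w * s i) else {})"
    (is "_ = _ \<union> ?B")
proof (intro equalityI subsetI)
  fix C assume C: "C \<in> reduced_subwords (cs @ [(i, b)]) w"
  show "C \<in> reduced_subwords cs w \<union> ?B"
  proof (cases "(i, b) \<in> set C")
    case False
    then show ?thesis using C by (auto simp: reduced_subwords_def)
  next
    case True
    then obtain C' x where C': "C = C' @ [x]" by (cases C rule: rev_cases) auto
    have sorted: "\<And>y. y \<in> set C' \<Longrightarrow> before y x" "sorted_wrt before C'"
      using C by (auto simp: reduced_subwords_def C' sorted_wrt_append)
    have x: "x = (i, b)"
    proof (rule ccontr)
      assume "x \<noteq> (i, b)"
      then have "x \<in> set cs" "(i, b) \<in> set C'" using True C C' by (auto simp: reduced_subwords_def)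
      then show False using sorted(1)[of "(i, b)"] assms
        by (auto simp: sorted_wrt_append before_def)
    qed
    have "(i, b) \<notin> set C'" using sorted(1)[of "(i, b)"] by (auto simp: before_def x)
    then have "set C' \<subseteq> set cs" using C by (auto simp: reduced_subwords_def C')
    then show ?thesis using C sorted(2)
      by (auto simp: reduced_subwords_def C' x snoc_in_reduced_words)
  qed
next
  fix C assume "C \<in> reduced_subwords cs w \<union> ?B"
  then show "C \<in> reduced_subwords (cs @ [(i, b)]) w"
    using assms
    by (auto simp: reduced_subwords_def snoc_in_reduced_words sorted_wrt_append subset_iff
        split: if_splits)
qed

text \<open>Each factor contributes either its 1 or its \<open>x_b u_i\<close>, and
  \<open>nil_mult\<close> kills the choices whose word is not reduced.\<close>

lemma apply_factors_expansion:
  "sorted_wrt before cs \<Longrightarrow>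
    apply_factors cs nil_one w = (\<Sum>C\<in>reduced_subwords cs w. prod_list (map mvar (map snd C)))"
proof (induction cs arbitrary: w rule: rev_induct)
  case Nil
  then show ?case by (simp add: reduced_subwords_Nil nil_one_def)
next
  case (snoc x cs)
  obtain i b where x: "x = (i, b)" by (cases x)
  have sorted: "sorted_wrt before cs" and last: "\<And>y. y \<in> set cs \<Longrightarrow> before y (i, b)"
    using snoc.prems by (auto simp: sorted_wrt_append x)
  have "(i, b) \<notin> set cs" using last[of "(i, b)"] by (auto simp: before_def)
  then have disj: "reduced_subwords cs w \<inter> (\<lambda>C. C @ [(i, b)]) ` reduced_subwords cs v = {}" for v
    by (auto simp: reduced_subwords_def)
  have inj: "inj_on (\<lambda>C. C @ [(i, b)]) A" for A by (auto simp: inj_on_def)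
  have "apply_factors (cs @ [x]) nil_one w = nil_exp i (mvar b) (apply_factors cs nil_one) w"
    by (simp add: x)
  also have "\<dots> = apply_factors cs nil_one w
      + mvar b * (if w \<langle>$\<rangle> (i + 1) < w \<langle>$\<rangle> i then apply_factors cs nil_one (w * s i) else 0)"
    by (simp only: nil_exp_def nil_mult_def)
  also have "\<dots> = (\<Sum>C\<in>reduced_subwords (cs @ [x]) w. prod_list (map mvar (map snd C)))"
    unfolding snoc.IH[OF sorted] using snoc.prems
    by (auto simp: x reduced_subwords_snoc sum.union_disjoint disj sum.reindex[OF inj]
        sum_distrib_left mult.commute simp del: map_map)
  finally show ?case .
qed

section \<open>The back stable series and its truncations\<close>

definition back_series :: "int perm \<Rightarrow> (int, rat) mfps" where
  "back_series w = Abs_mfps (\<lambda>M. of_nat (card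
    {(a, b). a \<in> reduced_words w \<and> b \<in> compatible_seqs a \<and> mset b = M}))"

text \<open>The effect of setting \<open>x_v\<close> to zero for all \<open>v < p\<close>.\<close>

definition truncate_below :: "int \<Rightarrow> (int, rat) mfps \<Rightarrow> (int, rat) mfps" where
  "truncate_below p f = Abs_mfps (\<lambda>M. if \<forall>v\<in>#M. p \<le> v then coeff f M else 0)"

lemma coeff_truncate_below [simp]:
  "coeff (truncate_below p f) M = (if \<forall>v\<in>#M. p \<le> v then coeff f M else 0)"
  by (simp add: truncate_below_def)

text \<open>Between neighbours with distinct letters, the weak increase of \<open>b\<close>, strict
  at ascents of \<open>a\<close>, says precisely that the pairs increase for \<open>before\<close>;
  transitivity extends this to the whole list.\<close>

lemma compatible_seqs_iff:
  assumes "distinct_adj a" "length b = length a"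
  shows "b \<in> compatible_seqs a \<longleftrightarrow>
    sorted_wrt before (zip a b) \<and> (\<forall>i<length a. b ! i \<le> a ! i)"
proof -
  have "transp before" by (auto simp: transp_def before_def)
  then have "sorted_wrt before (zip a b)
      \<longleftrightarrow> (\<forall>i. Suc i < length a \<longrightarrow> before (a ! i, b ! i) (a ! Suc i, b ! Suc i))"
    using assms(2) by (simp add: sorted_wrt_iff_nth_Suc_transp)
  also have "\<dots> \<longleftrightarrow> (\<forall>i. Suc i < length a \<longrightarrow> b ! i \<le> b ! Suc i)
      \<and> (\<forall>i. Suc i < length a \<longrightarrow> a ! i < a ! Suc i \<longrightarrow> b ! i < b ! Suc i)"
  proof -
    have "a ! i \<noteq> a ! Suc i" if "Suc i < length a" for i
      using assms(1) that by (auto simp: distinct_adj_conv_nth)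
    then show ?thesis by (fastforce simp: before_def)
  qed
  finally show ?thesis
    using assms(2) by (auto simp: compatible_seqs_def sorted_iff_nth_Suc)
qed

lemma reduced_word_less:
  fixes w :: "int perm"
  assumes "affected w \<subseteq> {..q}" "a \<in> reduced_words w" "x \<in> set a"
  shows "x < q"
proof -
  obtain l r where "affected w \<subseteq> {l..r}" by (rule affected_bounds)
  then have "affected w \<subseteq> {l..q}" using assms(1) by (simp add: subset_iff)
  then show ?thesis using reduced_word_bounds assms by fastforce
qed

text \<open>Zipping turns a reduced word and a compatible sequence into a reduced subword of
  \<open>factors n p\<close>. The hypothesis keeps the letters below \<open>p + int n\<close>, so
  the pairs lie among the factors precisely when the sequence stays at or above
  \<open>p\<close>.\<close>

lemma nil_product_eq_truncate_below:
  assumes "affected w \<subseteq> {..p + int n}"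
  shows "nil_product n p nil_one w = truncate_below p (back_series w)"
proof (rule mfps_eqI)
  fix M
  define S where "S = {C \<in> reduced_subwords (factors n p) w. mset (map snd C) = M}"
  define P where "P = {(a, b). a \<in> reduced_words w \<and> b \<in> compatible_seqs a \<and> mset b = M}"
  have "coeff (nil_product n p nil_one w) M = of_nat (card S)"
    unfolding nil_product_eq apply_factors_expansion[OF sorted_factors] coeff_sum
    by (simp add: coeff_monomial sum.If_cases S_def Int_def del: map_map mset_map)
  also have "card S = (if \<forall>v\<in>#M. p \<le> v then card P else 0)"
  proof (cases "\<forall>v\<in>#M. p \<le> v")
    case True
    have "bij_betw (\<lambda>C. (map fst C, map snd C)) S P"
    proof (rule bij_betw_byWitness[of _ "\<lambda>(a, b). zip a b"])
      show "\<forall>C\<in>S. (\<lambda>(a, b). zip a b) (map fst C, map snd C) = C"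
        by (simp add: zip_map_fst_snd)
      show "\<forall>x\<in>P. (map fst ((\<lambda>(a, b). zip a b) x), map snd ((\<lambda>(a, b). zip a b) x)) = x"
        by (auto simp: P_def compatible_seqs_def)
      show "(\<lambda>C. (map fst C, map snd C)) ` S \<subseteq> P"
      proof (clarsimp simp del: mset_map)
        fix C assume "C \<in> S"
        then have C: "sorted_wrt before C" "set C \<subseteq> set (factors n p)"
            "map fst C \<in> reduced_words w" "mset (map snd C) = M"
          by (auto simp: S_def reduced_subwords_def)
        have "snd (C ! i) \<le> fst (C ! i)" if "i < length C" for i
          using C(2) nth_mem[OF that] by (auto simp: set_factors)
        then have "map snd C \<in> compatible_seqs (map fst C)"
          using C by (subst compatible_seqs_iff)
            (auto simp: zip_map_fst_snd distinct_adj_reduced_word)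
        then show "(map fst C, map snd C) \<in> P" using C by (simp add: P_def)
      qed
      show "(\<lambda>(a, b). zip a b) ` P \<subseteq> S"
      proof clarify
        fix a b assume "(a, b) \<in> P"
        then have ab: "a \<in> reduced_words w" "b \<in> compatible_seqs a" "mset b = M"
          by (auto simp: P_def)
        then have len: "length b = length a" by (simp add: compatible_seqs_def)
        note c = compatible_seqs_iff[OF distinct_adj_reduced_word[OF ab(1)] len]
        have "x \<in> set (factors n p)" if "x \<in> set (zip a b)" for x
        proof -
          obtain i where i: "i < length a" "x = (a ! i, b ! i)"
            using \<open>x \<in> set (zip a b)\<close> len by (auto simp: in_set_zip)
          have "a ! i < p + int n" using reduced_word_less[OF assms ab(1)] i by simp
          moreover have "b ! i \<in># M" using i len by (simp flip: ab(3))
          then have "p \<le> b ! i" using True by simp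
          ultimately show ?thesis using i c ab(2) by (simp add: set_factors)
        qed
        then show "zip a b \<in> S"
          using ab len c by (auto simp: S_def reduced_subwords_def simp del: mset_map)
      qed
    qed
    then show ?thesis using True by (simp add: bij_betw_same_card)
  next
    case False
    have "S = {}"
    proof (rule ccontr)
      assume "S \<noteq> {}"
      then obtain C where "set C \<subseteq> set (factors n p)" "mset (map snd C) = M"
        by (auto simp: S_def reduced_subwords_def)
      then have "\<forall>v\<in>#M. p \<le> v" by (fastforce simp: set_factors)
      then show False using False by simp
    qed
    then show ?thesis using False by (subst if_not_P) simp_all
  qed
  finally show "coeff (nil_product n p nil_one w) M = coeff (truncate_below p (back_series w)) M"
    by (simp add: back_series_def P_def)
qed

lemma divided_difference_truncate_below:
  assumes "p \<le> i"
  shows "(mvar i - mvar (i + 1)) *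
      (if w \<langle>$\<rangle> (i + 1) < w \<langle>$\<rangle> i then truncate_below p (back_series (w * s i)) else 0)
    = truncate_below p (back_series w)
      - rename (Perm.apply (s i)) (truncate_below p (back_series w))"
proof -
  obtain l q where lq: "affected w \<subseteq> {l..q}" by (rule affected_bounds)
  \<comment> \<open>Large enough for the product to cover the integers moved by \<open>w\<close> and
    by \<open>w * s i\<close> and to contain the rows \<open>i\<close> and
    \<open>i + 1\<close>.\<close>
  define n where "n = nat (max q (i + 2) - p)"
  have n: "q \<le> p + int n" "i + 1 < p + int n" using assms by (auto simp: n_def)
  have w: "affected w \<subseteq> {min l i..p + int n}" using lq n by (fastforce simp: subset_iff)
  then have "affected (w * s i) \<subseteq> {min l i..p + int n}"
    using n by (intro affected_times_s) auto
  then have "nil_product n p nil_one (w * s i) = truncate_below p (back_series (w * s i))"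
    by (intro nil_product_eq_truncate_below) (simp add: subset_iff)
  moreover have "nil_product n p nil_one w = truncate_below p (back_series w)"
    using w by (intro nil_product_eq_truncate_below) (simp add: subset_iff)
  moreover have "divided_by_nil_mult i (nil_product n p nil_one)"
    using assms n by (intro divided_by_nil_mult_nil_product_invariant) (auto simp: nil_one_def)
  ultimately show ?thesis
    unfolding divided_by_nil_mult_def nil_mult_def by metis
qed

lemma divdiff_truncate_below:
  assumes "p \<le> i"
  shows "divdiff i (truncate_below p (back_series w)) =
    (if w \<langle>$\<rangle> (i + 1) < w \<langle>$\<rangle> i then truncate_below p (back_series (w * s i)) else 0)"
  by (rule divdiff_eqI) (rule divided_difference_truncate_below[OF assms])

text \<open>A single coefficient of the identity can be read off after truncation below
  \<open>i\<close> and below all variables of its monomial, where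
  \<open>divided_difference_truncate_below\<close> applies.\<close>

lemma divdiff_back_series:
  "divdiff i (back_series w) = (if w \<langle>$\<rangle> (i + 1) < w \<langle>$\<rangle> i then back_series (w * s i) else 0)"
    (is "_ = ?g")
proof (rule divdiff_eqI, rule mfps_eqI)
  fix M
  define p where "p = Min (insert i (set_mset M))"
  have p: "p \<le> i" "\<forall>v\<in>#M. p \<le> v" by (auto simp: p_def)
  have t: "(if w \<langle>$\<rangle> (i + 1) < w \<langle>$\<rangle> i then truncate_below p (back_series (w * s i)) else 0)
      = truncate_below p ?g"
    by (rule mfps_eqI) simp
  have "coeff ((mvar i - mvar (i + 1)) * ?g) M
      = coeff ((mvar i - mvar (i + 1)) * truncate_below p ?g) M"
    using p by (auto simp: left_diff_distrib coeff_mvar_mult dest: in_diffD simp del: if_cancel)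
  also have "\<dots> = coeff (truncate_below p (back_series w)
      - rename (Perm.apply (s i)) (truncate_below p (back_series w))) M"
    using divided_difference_truncate_below[OF p(1), of w] by (simp only: t)
  also have "\<dots> = coeff (back_series w - rename (Perm.apply (s i)) (back_series w)) M"
    using p by (auto simp: apply_s)
  finally show "coeff ((mvar i - mvar (i + 1)) * ?g) M
      = coeff (back_series w - rename (Perm.apply (s i)) (back_series w)) M" .
qed

lemma back_series_nonzeroE:
  assumes "coeff (back_series w) M \<noteq> 0"
  obtains a b where "a \<in> reduced_words w" "b \<in> compatible_seqs a" "mset b = M"
proof -
  have "{(a, b). a \<in> reduced_words w \<and> b \<in> compatible_seqs a \<and> mset b = M} \<noteq> {}"
    using assms unfolding back_series_def by (metis card.empty coeff_Abs_mfps of_nat_0)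
  then show ?thesis using that by auto
qed

lemma homogeneous_back_series: "homogeneous (len w) (back_series w)"
  by (auto simp: homogeneous_def compatible_seqs_def reduced_words_def elim!: back_series_nonzeroE)

text \<open>Variable indices are bounded because \<open>b\<close> stays below the letters of a
  reduced word. Below \<open>l\<close> there are no descents, so the divided differences vanish,
  which is invariance.\<close>

lemma back_series_in_ring: "back_series w \<in> back_stable_ring"
proof -
  obtain l q where lq: "affected w \<subseteq> {l..q}" by (rule affected_bounds)
  have "v \<le> q" if nonzero: "coeff (back_series w) M \<noteq> 0" and v: "v \<in># M" for M v
    using nonzero
  proof (rule back_series_nonzeroE)
    fix a b assume ab: "a \<in> reduced_words w" "b \<in> compatible_seqs a" "mset b = M"
    then obtain j where j: "j < length b" "v = b ! j" using v by (metis in_set_conv_nth set_mset_mset)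
    then have "v \<le> a ! j" "a ! j \<in> set a" using ab by (auto simp: compatible_seqs_def)
    then show "v \<le> q" using reduced_word_bounds[OF lq ab(1)] by fastforce
  qed
  moreover have "rename (Perm.apply (s i)) (back_series w) = back_series w" if "i < l" for i
  proof -
    have "\<not> w \<langle>$\<rangle> (i + 1) < w \<langle>$\<rangle> i" using descent_bounds[OF lq, of i] that by auto
    then show ?thesis using divdiff_spec[of i "back_series w"] by (simp add: divdiff_back_series)
  qed
  ultimately show ?thesis
    using homogeneous_back_series[of w]
    unfolding back_stable_ring_def homogeneous_def by (auto intro: exI[of _ "len w"])
qed

lemma has_formal_sum_back_series:
  "has_formal_sum (\<lambda>(a, b). prod_list (map mvar b))
    (SIGMA a:reduced_words w. compatible_seqs a) (back_series w)"
  unfolding has_formal_sum_def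
proof (intro allI conjI)
  fix M
  define F where "F = (\<lambda>(a :: int list, b). prod_list (map mvar b) :: (int, rat) mfps)"
  define S where "S = {x \<in> (SIGMA a:reduced_words w. compatible_seqs a). coeff (F x) M \<noteq> 0}"
  have F: "coeff (F (a, b)) M = (if mset b = M then 1 else 0)" for a b M
    by (simp add: F_def coeff_monomial)
  have S: "S = {(a, b). a \<in> reduced_words w \<and> b \<in> compatible_seqs a \<and> mset b = M}"
    by (auto simp: S_def F split: if_splits)
  \<comment> \<open>A sorted sequence is determined by its multiset, so each reduced word
    contributes at most one term. Hence \<open>card\<close> in \<open>back_series\<close> counts a
    finite set.\<close>
  have "S \<subseteq> reduced_words w \<times> {sorted_list_of_multiset M}"
    unfolding S by (auto simp: compatible_seqs_def sorted_sort_id)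
  then show "finite {x \<in> (SIGMA a:reduced_words w. compatible_seqs a).
      coeff ((\<lambda>(a, b). prod_list (map mvar b)) x :: (int, rat) mfps) M \<noteq> 0}"
    unfolding S_def[unfolded F_def, symmetric] by (rule finite_subset) simp
  have "(\<Sum>x\<in>S. coeff (F x) M) = (\<Sum>x\<in>S. 1)"
    by (rule sum.cong) (auto simp: S F)
  then have "coeff (back_series w) M = (\<Sum>x\<in>S. coeff (F x) M)"
    by (simp add: S back_series_def)
  then show "coeff (back_series w) M = (\<Sum>x | x \<in> (SIGMA a:reduced_words w. compatible_seqs a) \<and>
      coeff ((\<lambda>(a, b). prod_list (map mvar b)) x :: (int, rat) mfps) M \<noteq> 0.
      coeff ((\<lambda>(a, b). prod_list (map mvar b)) x) M)"
    unfolding S_def F_def .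
qed

lemma back_series_1: "back_series 1 = 1"
proof (rule mfps_eqI)
  fix M
  have "{(a, b). a \<in> reduced_words 1 \<and> b \<in> compatible_seqs a \<and> mset b = M}
      = (if M = {#} then {([], [])} else {})"
    by (auto simp: reduced_words_def compatible_seqs_def)
  then show "coeff (back_series 1) M = coeff 1 M"
    by (simp add: back_series_def coeff_1)
qed

section \<open>Schubert polynomials as truncations\<close>

lemma Sym_times_s: "w \<in> Sym n \<Longrightarrow> 1 \<le> i \<Longrightarrow> i < int n \<Longrightarrow> w * s i \<in> Sym n"
  using affected_times_s[of w 1 "int n" i] by (simp add: Sym_def)

text \<open>A zero would stay zero under the divided differences along descents, but these end at a
  series with constant term 1. This later shows that the longest element has a reduced subword at
  all.\<close>

lemma truncate_back_series_nonzero: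
  "w \<in> Sym n \<Longrightarrow> truncate_below 1 (back_series w) \<noteq> 0"
proof (induction "len w" arbitrary: w rule: less_induct)
  case less
  show ?case
  proof (cases "w = 1")
    case True
    have "coeff (truncate_below 1 (back_series w)) {#} = 1"
      by (simp add: True back_series_1 coeff_1)
    then show ?thesis by (metis coeff_0 zero_neq_one)
  next
    case False
    then obtain i where i: "w \<langle>$\<rangle> (i + 1) < w \<langle>$\<rangle> i" using exists_descent by blast
    then have "1 \<le> i" "i < int n" using descent_bounds[of w 1 "int n" i] less.prems by (simp_all add: Sym_def)
    then have "w * s i \<in> Sym n" using less.prems Sym_times_s by blast
    then have "truncate_below 1 (back_series (w * s i)) \<noteq> 0"
      using less.hyps[of "w * s i"] len_descent[OF i] by simp
    then show ?thesis using divdiff_truncate_below[OF \<open>1 \<le> i\<close>, of w] i by auto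
  qed
qed

section \<open>The longest element of \<open>Sym n\<close>\<close>

lemma inversions_Sym:
  assumes "w \<in> Sym n"
  shows "inversions w \<subseteq> {(i, j). 1 \<le> i \<and> i < j \<and> j \<le> int n}"
proof clarify
  fix i j assume ij: "(i, j) \<in> inversions w"
  have "inversions w \<subseteq> {1..int n} \<times> {1..int n}"
    using assms by (intro inversions_bounded) (simp add: Sym_def)
  with ij have "(i, j) \<in> {1..int n} \<times> {1..int n}" by (rule subsetD[rotated])
  moreover have "i < j" using ij by (simp add: inversions_def)
  ultimately show "1 \<le> i \<and> i < j \<and> j \<le> int n" by simp
qed

lemma inversions_longest:
  assumes "w \<in> Sym n" "\<And>i. 1 \<le> i \<Longrightarrow> i < int n \<Longrightarrow> w \<langle>$\<rangle> (i + 1) < w \<langle>$\<rangle> i"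
  shows "inversions w = {(i, j). 1 \<le> i \<and> i < j \<and> j \<le> int n}"
proof -
  have "j \<le> int n \<longrightarrow> w \<langle>$\<rangle> j < w \<langle>$\<rangle> i" if "i < j" "1 \<le> i" for i j
    using that(1)
  proof (induction j rule: int_gr_induct)
    case base
    then show ?case using assms(2)[of i] that by auto
  next
    case (step j)
    then show ?case using assms(2)[of j] that by auto
  qed
  then have "{(i, j). 1 \<le> i \<and> i < j \<and> j \<le> int n} \<subseteq> inversions w"
    by (auto simp: inversions_def)
  then show ?thesis using inversions_Sym[OF assms(1)] by (rule equalityI[rotated])
qed

lemma len_le_longest:
  assumes "w \<in> Sym n" "\<And>i. 1 \<le> i \<Longrightarrow> i < int n \<Longrightarrow> w \<langle>$\<rangle> (i + 1) < w \<langle>$\<rangle> i" "v \<in> Sym n"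
  shows "len v \<le> len w"
proof -
  have "inversions w = {(i, j). 1 \<le> i \<and> i < j \<and> j \<le> int n}"
    using assms(1,2) by (rule inversions_longest)
  then have "inversions v \<subseteq> inversions w" using inversions_Sym[OF assms(3)] by simp
  then show ?thesis by (simp add: len_eq_card_inversions card_mono)
qed

lemma descent_if_longest:
  assumes "w \<in> Sym n" "\<And>v. v \<in> Sym n \<Longrightarrow> len v \<le> len w" "1 \<le> i" "i < int n"
  shows "w \<langle>$\<rangle> (i + 1) < w \<langle>$\<rangle> i"
proof -
  have "w * s i \<in> Sym n" using assms Sym_times_s by blast
  then show ?thesis using assms(2) len_ascent[of w i] apply_neq_Suc[of w i] by force
qed

lemma reduced_subword_full:
  "sorted_wrt before cs \<Longrightarrow> C \<in> reduced_subwords cs w \<Longrightarrow>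
    length C \<le> length cs \<and> (length C = length cs \<longrightarrow> C = cs)"
proof (induction cs arbitrary: C w rule: rev_induct)
  case (snoc x cs)
  obtain i b where x: "x = (i, b)" by (cases x)
  have sorted: "sorted_wrt before cs" using snoc.prems by (simp add: sorted_wrt_append)
  have "C \<in> reduced_subwords cs w \<or> (\<exists>C'\<in>reduced_subwords cs (w * s i). C = C' @ [x])"
    using snoc.prems by (auto simp: x reduced_subwords_snoc split: if_splits)
  then show ?case using snoc.IH[OF sorted] by fastforce
qed (simp add: reduced_subwords_Nil split: if_splits)

lemma prod_list_row_factors:
  "prod_list (map mvar (map snd (row_factors m k b))) = (mvar b ^ m :: (int, rat) mfps)"
  by (induction m arbitrary: k) (simp_all add: mult.commute)

lemma prod_list_factors:
  "prod_list (map mvar (map snd (factors n k)))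
    = (\<Prod>j<n. mvar (k + int j) ^ (n - j) :: (int, rat) mfps)"
proof (induction n arbitrary: k)
  case (Suc n)
  show ?case
    unfolding prod.lessThan_Suc_shift
    using Suc[of "k + 1"] prod_list_row_factors[of "Suc n" k k]
    by (simp add: add.assoc del: map_map row_factors.simps power_Suc)
qed simp

text \<open>The product has exactly as many factors as \<open>w\<close> has inversions, so only the
  choice of all factors gives a long enough word; \<open>truncate_back_series_nonzero\<close> shows
  that this choice does occur.\<close>

lemma truncate_back_series_longest:
  assumes "w \<in> Sym n" "\<And>i. 1 \<le> i \<Longrightarrow> i < int n \<Longrightarrow> w \<langle>$\<rangle> (i + 1) < w \<langle>$\<rangle> i"
  shows "truncate_below 1 (back_series w) = (\<Prod>i\<in>{1..<n}. mvar (int i) ^ (n - i))"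
proof -
  let ?cs = "factors (n - 1) 1"
  have inv: "inversions w = {(i, j). 1 \<le> i \<and> i < j \<and> j \<le> int n}"
    using assms by (rule inversions_longest)
  \<comment> \<open>The inversion \<open>(i, j)\<close> corresponds to the factor with variable
    \<open>x_i\<close> and generator of index \<open>j - 1\<close>.\<close>
  have "bij_betw (\<lambda>(i, j). (j - 1, i)) (inversions w) (set ?cs)"
    unfolding inv set_factors
    by (rule bij_betw_byWitness[of _ "\<lambda>(i, j). (j, i + 1)"]) auto
  moreover have "distinct ?cs"
    by (rule sorted_before_distinct) (rule sorted_factors)
  ultimately have len: "len w = length ?cs"
    by (simp add: len_eq_card_inversions bij_betw_same_card distinct_card)
  have "reduced_subwords ?cs w \<subseteq> {?cs}"
  proof
    fix C assume C: "C \<in> reduced_subwords ?cs w"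
    then have "length (map fst C) = len w" by (simp add: reduced_subwords_def reduced_words_def)
    then have "length C = length ?cs" by (simp add: len)
    then show "C \<in> {?cs}" using reduced_subword_full[OF sorted_factors C] by simp
  qed
  moreover have eq: "truncate_below 1 (back_series w)
      = (\<Sum>C\<in>reduced_subwords ?cs w. prod_list (map mvar (map snd C)))"
    unfolding apply_factors_expansion[OF sorted_factors, symmetric] nil_product_eq[symmetric]
    by (rule nil_product_eq_truncate_below[symmetric]) (use assms(1) in \<open>auto simp: Sym_def\<close>)
  moreover have "reduced_subwords ?cs w \<noteq> {}"
    using truncate_back_series_nonzero[OF assms(1)] eq by auto
  ultimately have "truncate_below 1 (back_series w) = prod_list (map mvar (map snd ?cs))"
    by (simp add: subset_singleton_iff del: map_map)
  also have "\<dots> = (\<Prod>j<n - 1. mvar (1 + int j) ^ (n - 1 - j))"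
    by (rule prod_list_factors)
  also have "\<dots> = (\<Prod>i\<in>{1..<n}. mvar (int i) ^ (n - i))"
    by (rule prod.reindex_bij_witness[of _ "\<lambda>i. i - 1" Suc]) auto
  finally show ?thesis .
qed

text \<open>Uniqueness: the truncation has the right start value and obeys the recursion, so every
  chain of descents, for every \<open>n\<close>, computes it.\<close>

lemma schubert_rel_imp_truncate:
  "schubert_rel n w f \<Longrightarrow> w \<in> Sym n \<and> f = truncate_below 1 (back_series w)"
proof (induction rule: schubert_rel.induct)
  case (longest w)
  then have "w \<langle>$\<rangle> (i + 1) < w \<langle>$\<rangle> i" if "1 \<le> i" "i < int n" for i
    using that by (intro descent_if_longest) auto
  then show ?case using truncate_back_series_longest[of w n] longest by simp
next
  case (descend w i f)
  have "w * s i * s i \<in> Sym n"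
    using descend Sym_times_s by blast
  moreover have "(w * s i) \<langle>$\<rangle> (i + 1) < (w * s i) \<langle>$\<rangle> i"
    using descent_iff[of "w * s i" i] descend by simp
  ultimately show ?case
    using descend divdiff_truncate_below[of 1 i "w * s i"] by simp
qed

text \<open>Existence: as long as some ascent remains, it leads to a longer element of
  \<open>Sym n\<close>, and \<open>n * n\<close> bounds the length.\<close>

lemma schubert_rel_truncate:
  "w \<in> Sym n \<Longrightarrow> schubert_rel n w (truncate_below 1 (back_series w))"
proof (induction "n * n - len w" arbitrary: w rule: less_induct)
  case less
  show ?case
  proof (cases "\<forall>i. 1 \<le> i \<longrightarrow> i < int n \<longrightarrow> w \<langle>$\<rangle> (i + 1) < w \<langle>$\<rangle> i")
    case True
    then have "schubert_rel n w (\<Prod>i\<in>{1..<n}. mvar (int i) ^ (n - i))"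
      using less.prems len_le_longest by (intro schubert_rel.longest) auto
    then show ?thesis using truncate_back_series_longest[OF less.prems] True by simp
  next
    case False
    then obtain i where i: "1 \<le> i" "i < int n" "w \<langle>$\<rangle> i < w \<langle>$\<rangle> (i + 1)"
      using apply_neq_Suc[of w] by (metis linorder_neqE)
    then have ws: "w * s i \<in> Sym n" using less.prems Sym_times_s by blast
    have "len (w * s i) \<le> card ({1..int n} \<times> {1..int n})"
      unfolding len_eq_card_inversions
      using ws inversions_bounded by (intro card_mono) (auto simp: Sym_def)
    then have "len (w * s i) \<le> n * n" by (simp add: card_cartesian_product)
    then have "schubert_rel n (w * s i) (truncate_below 1 (back_series (w * s i)))"
      using len_ascent[OF i(3)] ws by (intro less.hyps) auto
    then have "schubert_rel n w (divdiff i (truncate_below 1 (back_series (w * s i))))"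
      using i len_ascent[OF i(3)] by (intro schubert_rel.descend) auto
    then show ?thesis using i divdiff_truncate_below[of 1 i "w * s i"] by (simp add: apply_times_s)
  qed
qed

lemma schubert_eq_truncate:
  assumes "w \<in> Sym n"
  shows "schubert w = truncate_below 1 (back_series w)"
  unfolding schubert_def
  by (rule the_equality) (use assms schubert_rel_truncate schubert_rel_imp_truncate in blast)+

section \<open>Translation to an arbitrary interval\<close>

lemma bij_add_int: "bij (\<lambda>j. j + k :: int)"
  by (rule bij_betw_byWitness[of _ "\<lambda>j. j - k"]) auto

lemma shift_perm_0 [simp]: "shift_perm 0 w = w"
  by (rule perm_eqI) (simp add: shift_perm.rep_eq)

lemma shift_perm_eq_1_iff: "shift_perm k w = 1 \<longleftrightarrow> w = 1"
proof -
  have one: "shift_perm c 1 = 1" for c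
    by (rule perm_eqI) (simp add: shift_perm.rep_eq)
  then show ?thesis by (metis add.left_inverse shift_perm_0 shift_perm_shift_perm)
qed

text \<open>Shifting variables and generators together carries a factor to its translate. Arbitrary
  related \<phi> and \<psi> are allowed so that the shift can be passed through a whole
  product.\<close>

lemma rename_nil_exp_shift:
  assumes "\<And>v. rename (\<lambda>j. j + k) (\<phi> v) = \<psi> (shift_perm k v)"
  shows "rename (\<lambda>j. j + k) (nil_exp i x \<phi> w)
    = nil_exp (i + k) (rename (\<lambda>j. j + k) x) \<psi> (shift_perm k w)"
proof -
  have "shift_perm k w * s (i + k) = shift_perm k (w * s i)"
    by (simp add: shift_perm_mult shift_perm_s)
  then show ?thesis
    by (simp add: nil_exp_def nil_mult_def rename_add rename_mult bij_add_int assms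
        shift_perm.rep_eq)
qed

lemma rename_nil_row_shift:
  assumes "\<And>v. rename (\<lambda>j. j + k) (\<phi> v) = \<psi> (shift_perm k v)"
  shows "rename (\<lambda>j. j + k) (nil_row m i x \<phi> w)
    = nil_row m (i + k) (rename (\<lambda>j. j + k) x) \<psi> (shift_perm k w)"
proof (induction m arbitrary: i w)
  case (Suc m)
  then show ?case
    using rename_nil_exp_shift[of k "nil_row m (i + 1) x \<phi>"] by (simp add: add_ac)
qed (simp add: assms)

lemma rename_nil_product_shift:
  "(\<And>v. rename (\<lambda>j. j + k) (\<phi> v) = \<psi> (shift_perm k v)) \<Longrightarrow>
    rename (\<lambda>j. j + k) (nil_product n p \<phi> w) = nil_product n (p + k) \<psi> (shift_perm k w)"
proof (induction n arbitrary: p \<phi> \<psi>)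
  case (Suc n)
  have "rename (\<lambda>j. j + k) (nil_row (Suc n) p (mvar p) \<phi> v)
      = nil_row (Suc n) (p + k) (mvar (p + k)) \<psi> (shift_perm k v)" for v
    using rename_nil_row_shift[of k \<phi> \<psi>] Suc.prems
    by (simp add: rename_mvar bij_add_int del: nil_row.simps)
  then have "rename (\<lambda>j. j + k) (nil_product n (p + 1) (nil_row (Suc n) p (mvar p) \<phi>) w)
      = nil_product n (p + 1 + k) (nil_row (Suc n) (p + k) (mvar (p + k)) \<psi>) (shift_perm k w)"
    by (rule Suc.IH)
  then show ?case by (simp add: add_ac del: nil_row.simps)
qed simp

text \<open>The truncation at 1 is written as a product, whose factors translate one by one, and the
  translated product is read as the truncation at \<open>p\<close>.\<close>

lemma schubert_interval_eq_truncate: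
  assumes "affected w \<subseteq> {p..}"
  shows "schubert_interval p q w = truncate_below p (back_series w)"
proof -
  obtain l r where lr: "affected w \<subseteq> {l..r}" by (rule affected_bounds)
  \<comment> \<open>\<open>n\<close> is the number of integers in \<open>{p..r}\<close>; for
    \<open>r < p\<close> it is 0 and \<open>w\<close> moves nothing.\<close>
  define n v where "n = nat (r - p + 1)" and "v = shift_perm (1 - p) w"
  have n: "affected w \<subseteq> {p..p + int n - 1}" using assms lr by (fastforce simp: n_def)
  have "affected v \<subseteq> {1..int n}"
  proof
    fix j assume "j \<in> affected v"
    then have "j + p - 1 \<in> affected w"
      by (auto simp: v_def in_affected shift_perm.rep_eq algebra_simps)
    then show "j \<in> {1..int n}" using n by auto
  qed
  then have v: "v \<in> Sym n" by (simp add: Sym_def)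
  have "schubert v = nil_product n 1 nil_one v"
    using v schubert_eq_truncate[OF v]
    by (subst nil_product_eq_truncate_below) (auto simp: Sym_def)
  moreover have "rename (\<lambda>j. j + (p - 1)) (nil_product n 1 nil_one v)
      = nil_product n (1 + (p - 1)) nil_one (shift_perm (p - 1) v)"
    by (rule rename_nil_product_shift) (simp add: nil_one_def shift_perm_eq_1_iff)
  ultimately have "schubert_interval p q w = nil_product n p nil_one w"
    by (simp add: schubert_interval_def v_def shift_perm_shift_perm)
  also have "\<dots> = truncate_below p (back_series w)"
    using n by (intro nil_product_eq_truncate_below) auto
  finally show ?thesis .
qed

section \<open>The coefficientwise limit\<close>

lemma coeffwise_limit_unique:
  assumes "coeffwise_limit f F L" "coeffwise_limit f F L'" "F \<noteq> bot"
  shows "L = L'"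
proof (rule mfps_eqI)
  fix M
  have "\<forall>\<^sub>F x in F. coeff L M = coeff L' M"
    using assms(1,2)[unfolded coeffwise_limit_def, rule_format, of M]
    by eventually_elim simp
  then show "coeff L M = coeff L' M" using eventually_happens'[OF assms(3)] by blast
qed

text \<open>The coefficient at \<open>M\<close> is stable once \<open>p\<close> lies at or below the
  integers moved by \<open>w\<close> and the variables of \<open>M\<close>.\<close>

lemma coeffwise_limit_schubert_interval:
  "coeffwise_limit (\<lambda>(p, q). schubert_interval p q w) (at_bot \<times>\<^sub>F at_top) (back_series w)"
  unfolding coeffwise_limit_def
proof
  fix M
  obtain l r where lr: "affected w \<subseteq> {l..r}" by (rule affected_bounds)
  define P where "P = Min (insert l (set_mset M))"
  have P: "P \<le> l" "\<forall>v\<in>#M. P \<le> v" by (auto simp: P_def)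
  have "coeff (schubert_interval p q w) M = coeff (back_series w) M" if "p \<le> P" for p q
  proof -
    have "affected w \<subseteq> {p..}" using lr P that by auto
    then show ?thesis using P that by (auto simp: schubert_interval_eq_truncate)
  qed
  then show "\<forall>\<^sub>F x in at_bot \<times>\<^sub>F at_top. coeff (case x of (p, q) \<Rightarrow> schubert_interval p q w) M
      = coeff (back_series w) M"
    unfolding eventually_prod_filter
    by (intro exI[of _ "\<lambda>p. p \<le> P"] exI[of _ "\<lambda>_. True"]) (auto simp: eventually_le_at_bot)
qed

lemma back_schubert_eq_back_series: "back_schubert w = back_series w"
  unfolding back_schubert_def
proof (rule the_equality)
  show "coeffwise_limit (\<lambda>(p, q). schubert_interval p q w) (at_bot \<times>\<^sub>F at_top) (back_series w)"
    by (rule coeffwise_limit_schubert_interval)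
next
  fix L assume "coeffwise_limit (\<lambda>(p, q). schubert_interval p q w) (at_bot \<times>\<^sub>F at_top) L"
  then show "L = back_series w"
    by (rule coeffwise_limit_unique[OF _ coeffwise_limit_schubert_interval])
      (simp add: prod_filter_eq_bot trivial_limit_at_bot_linorder)
qed

section \<open>Uniqueness\<close>

text \<open>Invariance under all \<open>s\<^sub>i\<close> lets a variable of a monomial drift beyond any upper bound.\<close>

lemma symmetric_bounded_constant:
  assumes sym: "\<And>i. rename (Perm.apply (s i)) f = f"
    and bounded: "\<And>M v. coeff f M \<noteq> 0 \<Longrightarrow> v \<in># M \<Longrightarrow> v \<le> N"
    and "v \<in># M"
  shows "coeff f M = 0"
proof (rule ccontr)
  assume nz: "coeff f M \<noteq> 0"
  have "\<exists>M'. coeff f M' = coeff f M \<and> v + int k \<in># M'" for k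
  proof (induction k)
    case (Suc k)
    then obtain M' where M': "coeff f M' = coeff f M" "v + int k \<in># M'" by blast
    let ?t = "Perm.apply (s (v + int k))"
    have "coeff f (image_mset ?t M') = coeff f M'"
      using sym[of "v + int k"] by (metis coeff_rename inv_s)
    moreover have "v + int (Suc k) \<in># image_mset ?t M'"
      using imageI[OF M'(2), of ?t] by (simp add: apply_s add_ac)
    ultimately show ?case using M' by metis
  qed (use assms in auto)
  \<comment> \<open>This many steps carry the variable to an index above \<open>N\<close>.\<close>
  then obtain M' where "coeff f M' = coeff f M" "v + int (nat (N - v + 1)) \<in># M'" by blast
  then show False using bounded[of M' "v + int (nat (N - v + 1))"] nz by (simp split: if_splits)
qed

lemma back_series_unique:
  fixes G :: "int perm \<Rightarrow> (int, rat) mfps"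
  assumes ring: "\<And>w. G w \<in> back_stable_ring"
    and one: "G 1 = 1"
    and hom: "\<And>w. homogeneous (len w) (G w)"
    and dd: "\<And>w i. divdiff i (G w) = (if len (w * s i) < len w then G (w * s i) else 0)"
  shows "G w = back_series w"
proof (induction "len w" arbitrary: w rule: less_induct)
  case less
  show ?case
  proof (cases "w = 1")
    case False
    define f where "f = G w - back_series w"
    \<comment> \<open>Both sides vanish unless \<open>i\<close> is a descent, and then
      \<open>w * s i\<close> is shorter, so the induction hypothesis applies.\<close>
    have "divdiff i (G w) = divdiff i (back_series w)" for i
      using less[of "w * s i"] by (auto simp: dd divdiff_back_series descent_iff)
    then have eq: "G w - rename (Perm.apply (s i)) (G w)
        = back_series w - rename (Perm.apply (s i)) (back_series w)" for i
      using divdiff_spec[of i "G w"] divdiff_spec[of i "back_series w"] by simp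
    have sym: "rename (Perm.apply (s i)) f = f" for i
      using eq[of i] by (simp add: f_def rename_diff algebra_simps)
    obtain N1 where N1: "\<And>M v. coeff (G w) M \<noteq> 0 \<Longrightarrow> v \<in># M \<Longrightarrow> v \<le> N1"
      using ring[of w] by (auto simp: back_stable_ring_def)
    obtain N2 where N2: "\<And>M v. coeff (back_series w) M \<noteq> 0 \<Longrightarrow> v \<in># M \<Longrightarrow> v \<le> N2"
      using back_series_in_ring[of w] by (auto simp: back_stable_ring_def)
    have bounded: "v \<le> max N1 N2" if "coeff f M \<noteq> 0" "v \<in># M" for M v
    proof (cases "coeff (G w) M = 0")
      case True
      then show ?thesis using that N2[of M v] by (auto simp: f_def)
    next
      case False
      then show ?thesis using that N1[of M v] by auto
    qed
    \<comment> \<open>Invariance kills every coefficient at a nonempty monomial; the constant term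
      vanishes because both series are homogeneous of positive degree \<open>len w\<close>.\<close>
    have "coeff f M = 0" for M
    proof (cases "M = {#}")
      case True
      have "len w \<noteq> size M" using False True by (simp add: len_eq_0_iff)
      then have "coeff (G w) M = 0" "coeff (back_series w) M = 0"
        using hom[of w] homogeneous_back_series[of w] by (auto simp: homogeneous_def)
      then show ?thesis by (simp add: f_def)
    next
      case False
      then obtain v where "v \<in># M" by (meson multiset_nonemptyE)
      then show ?thesis using sym bounded by (intro symmetric_bounded_constant[of f "max N1 N2" v M])
    qed
    then show ?thesis by (intro mfps_eqI) (simp add: f_def)
  qed (simp add: one back_series_1)
qed

theorem theorem3p2:
  shows "(\<forall>w. coeffwise_limit (\<lambda>(p, q). schubert_interval p q w) (at_bot \<times>\<^sub>F at_top) (back_schubert w)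
            \<and> back_schubert w \<in> back_stable_ring
            \<and> has_formal_sum (\<lambda>(a, b). prod_list (map mvar b))
                (SIGMA a:reduced_words w. compatible_seqs a) (back_schubert w))
       \<and> (\<forall>G :: int perm \<Rightarrow> (int, rat) mfps.
            ((\<forall>w. G w \<in> back_stable_ring)
             \<and> G 1 = 1
             \<and> (\<forall>w. homogeneous (len w) (G w))
             \<and> (\<forall>w i. divdiff i (G w) = (if len (w * s i) < len w then G (w * s i) else 0)))
            \<longleftrightarrow> G = back_schubert)"
proof -
  have eq: "back_schubert = back_series" by (rule ext) (rule back_schubert_eq_back_series)
  show ?thesis
    unfolding eq
    using coeffwise_limit_schubert_interval back_series_in_ring has_formal_sum_back_series
      back_series_1 homogeneous_back_series divdiff_back_series back_series_unique
    by (auto simp: descent_iff fun_eq_iff)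
qed

end
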